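(* Let $N\geq 1$ be an integer and let $\Phi_N:\mathcal{T}(\ell^2(\mathbb{F}_\infty))\to\mathcal{T}(\ell^2(\mathbb{F}_\infty))$ be the quantum channel $\Phi_N(\rho)=\frac1N\sum_{i=1}^N U_i\rho U_i^*$. For any $k\in\mathbb{N}$ we have $$H_{min}(\Phi_N^{\otimes k})\geq k\log(N)-2\log\left(1+\sqrt{(1+9N^{-1})^k-1}\right).$$ In particular, the regularized MOE satisfies $$\overline{H}_{min}(\Phi_N)\geq\log(N)-\log\left(1+\frac9N\right)\geq\log(N)-\frac9N.$$
   Context: $\mathbb{F}_\infty$ is the free group on countably many free generators $g_1,g_2,\dots$. For $i\in\mathbb{N}$, $U_i$ is the unitary operator on $\ell^2(\mathbb{F}_\infty)$ given by $(U_if)(x)=f(g_i^{-1}x)$. $\mathcal{T}(H)$ denotes the trace class operators on a Hilbert space $H$. A state on $H$ is a positive element of $\mathcal{T}(H)$ of trace $1$. The von Neumann entropy of a state $\rho$ with eigenvalues $\lambda_1(\rho)\geq\lambda_2(\rho)\geq\cdots$ (counted with multiplicity) is $H(\rho)=-\sum_i\lambda_i(\rho)\log\lambda_i(\rho)$ (natural logarithm, $0\log 0=0$). The tensor power $\Phi_N^{\otimes k}:\mathcal{T}(\ell^2(\mathbb{F}_\infty^k))\to\mathcal{T}(\ell^2(\mathbb{F}_\infty^k))$ (identifying $\ell^2(\mathbb{F}_\infty)^{\otimes k}$ with $\ell^2(\mathbb{F}_\infty^k)$) is $\Phi_N^{\otimes k}(\rho)=\frac1{N^k}\sum_{i_1,\dots,i_k=1}^N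 (U_{i_1}\otimes\cdots\otimes U_{i_k})\rho(U_{i_1}\otimes\cdots\otimes U_{i_k})^*$. For a quantum channel $\Phi$, the minimum output entropy (MOE) is $H_{min}(\Phi)=\inf_{\xi}H(\Phi(|\xi\rangle\langle\xi|))$, with the infimum over all unit vectors $\xi$ in the input Hilbert space, and the regularized MOE is $\overline{H}_{min}(\Phi)=\lim_{k\to\infty}\frac1k H_{min}(\Phi^{\otimes k})$. *)

theory Defs
  imports "HOL-Analysis.Analysis" "HOL-Library.Function_Algebras" "HOL-Algebra.Group"
begin

section \<open>The free group on countably many generators\<close>

text \<open>
  The letter \<open>(i, True)\<close> stands for the generator numbered \<open>i\<close> and \<open>(i, False)\<close> for its
  inverse; group elements are the reduced words. The generators are numbered from 0.
\<close>

type_synonym letter = "nat \<times> bool"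

definition inv_letter :: "letter \<Rightarrow> letter" where
  "inv_letter a = (fst a, \<not> snd a)"

definition reduced :: "letter list \<Rightarrow> bool" where
  "reduced = successively (\<lambda>a b. b \<noteq> inv_letter a)"

fun push_letter :: "letter \<Rightarrow> letter list \<Rightarrow> letter list" where
  "push_letter a [] = [a]"
| "push_letter a (b # w) = (if b = inv_letter a then w else a # b # w)"

definition free_group :: "letter list monoid" where
  "free_group = \<lparr>carrier = {w. reduced w}, mult = foldr push_letter, one = []\<rparr>"

definition free_gen :: "nat \<Rightarrow> letter list" where
  "free_gen i = [(i, True)]"

lemma inv_letter_inv_letter [simp]: "inv_letter (inv_letter a) = a"
  by (simp add: inv_letter_def)

lemma inv_letter_eq_iff: "a = inv_letter b \<longleftrightarrow> b = inv_letter a"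
  by auto

lemma reduced_simps [simp]:
  "reduced []" "reduced [a]" "reduced (a # b # w) \<longleftrightarrow> b \<noteq> inv_letter a \<and> reduced (b # w)"
  by (simp_all add: reduced_def)

lemma reduced_tl: "reduced (a # w) \<Longrightarrow> reduced w"
  by (cases w) auto

lemma reduced_push: "reduced w \<Longrightarrow> reduced (push_letter a w)"
  by (cases w) (auto dest: reduced_tl)

lemma reduced_foldr_push: "reduced v \<Longrightarrow> reduced (foldr push_letter u v)"
  by (induction u) (auto simp: reduced_push)

lemma push_push_inv: "reduced w \<Longrightarrow> push_letter a (push_letter (inv_letter a) w) = w"
  by (cases w; cases "tl w") auto

lemma push_inv_push: "reduced w \<Longrightarrow> push_letter (inv_letter a) (push_letter a w) = w"
  using push_push_inv[of w "inv_letter a"] by simp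

lemma foldr_push_assoc:
  assumes "reduced v" "reduced w"
  shows "foldr push_letter (foldr push_letter u v) w = foldr push_letter u (foldr push_letter v w)"
proof (induction u)
  case (Cons a u)
  define t where "t = foldr push_letter u v"
  have "foldr push_letter (push_letter a t) w = push_letter a (foldr push_letter t w)"
  proof (cases t)
    case (Cons b s)
    show ?thesis
    proof (cases "b = inv_letter a")
      case True
      then show ?thesis
        using Cons push_push_inv[OF reduced_foldr_push[OF assms(2), of s], of a] by simp
    qed (simp add: Cons)
  qed simp
  then show ?case
    using Cons.IH by (simp add: t_def)
qed simp

lemma foldr_push_inverse: "foldr push_letter (rev (map inv_letter u)) u = []"
proof -
  have "foldr push_letter (rev (map inv_letter u)) (u @ w) = w" for w
    by (induction u) simp_all
  from this[of "[]"] show ?thesis by simp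
qed

lemma reduced_inverse: "reduced u \<Longrightarrow> reduced (rev (map inv_letter u))"
  unfolding reduced_def successively_rev successively_map
  by (erule successively_mono) (metis inv_letter_inv_letter)

lemma foldr_push_Nil: "reduced u \<Longrightarrow> foldr push_letter u [] = u"
proof (induction u)
  case (Cons a u)
  then show ?case by (cases u) (auto dest: reduced_tl)
qed simp

lemma group_free_group: "group free_group"
proof (rule groupI)
  fix u assume "u \<in> carrier free_group"
  then show "\<exists>v\<in>carrier free_group. v \<otimes>\<^bsub>free_group\<^esub> u = \<one>\<^bsub>free_group\<^esub>"
    by (intro bexI[of _ "rev (map inv_letter u)"])
       (simp_all add: free_group_def foldr_push_inverse reduced_inverse)
qed (simp_all add: free_group_def reduced_foldr_push foldr_push_assoc)


section \<open>Operators on \<open>\<ell>\<^sup>2\<close>\<close>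

text \<open>
  The Hilbert space \<open>\<ell>\<^sup>2(S)\<close> consists of functions on the whole type that vanish off \<open>S\<close>.
  Operators on it are undefined off \<open>\<ell>\<^sup>2(S)\<close>, so that they are equal if they agree on \<open>\<ell>\<^sup>2(S)\<close>.
\<close>

definition ell2 :: "'a set \<Rightarrow> ('a \<Rightarrow> complex) set" where
  "ell2 S = {f. (\<forall>x. x \<notin> S \<longrightarrow> f x = 0) \<and> (\<lambda>x. (cmod (f x))\<^sup>2) summable_on S}"

definition ell2_inner :: "('a \<Rightarrow> complex) \<Rightarrow> ('a \<Rightarrow> complex) \<Rightarrow> complex" where
  "ell2_inner f g = (\<Sum>\<^sub>\<infinity>x. cnj (f x) * g x)"

definition ell2_norm :: "('a \<Rightarrow> complex) \<Rightarrow> real" where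
  "ell2_norm f = sqrt (\<Sum>\<^sub>\<infinity>x. (cmod (f x))\<^sup>2)"

definition basis_vec :: "'a \<Rightarrow> 'a \<Rightarrow> complex" where
  "basis_vec x = (\<lambda>y. if y = x then 1 else 0)"

type_synonym 'a operator = "('a \<Rightarrow> complex) \<Rightarrow> ('a \<Rightarrow> complex)"

definition bounded_op :: "'a set \<Rightarrow> 'a operator \<Rightarrow> bool" where
  "bounded_op S A \<longleftrightarrow>
     A \<in> ell2 S \<rightarrow>\<^sub>E ell2 S \<and>
     (\<forall>f\<in>ell2 S. \<forall>g\<in>ell2 S. A (\<lambda>x. f x + g x) = (\<lambda>x. A f x + A g x)) \<and>
     (\<forall>c. \<forall>f\<in>ell2 S. A (\<lambda>x. c * f x) = (\<lambda>x. c * A f x)) \<and>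
     (\<exists>C. \<forall>f\<in>ell2 S. ell2_norm (A f) \<le> C * ell2_norm f)"

definition adjoint_op :: "'a set \<Rightarrow> 'a operator \<Rightarrow> 'a operator" where
  "adjoint_op S A =
     (THE B. bounded_op S B \<and>
        (\<forall>f\<in>ell2 S. \<forall>g\<in>ell2 S. ell2_inner (A f) g = ell2_inner f (B g)))"

definition positive_op :: "'a set \<Rightarrow> 'a operator \<Rightarrow> bool" where
  "positive_op S A \<longleftrightarrow>
     bounded_op S A \<and> (\<forall>f\<in>ell2 S. ell2_inner f (A f) \<in> \<real> \<and> 0 \<le> Re (ell2_inner f (A f)))"

text \<open>The operator \<open>P\<close> below is the absolute value \<open>|A| = (A\<^sup>*A)\<^sup>1\<^sup>/\<^sup>2\<close>, required to have finite trace.\<close>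

definition trace_class :: "'a set \<Rightarrow> 'a operator set" where
  "trace_class S =
     {A. bounded_op S A \<and>
        (\<exists>P. positive_op S P \<and>
           (\<forall>f\<in>ell2 S. P (P f) = adjoint_op S A (A f)) \<and>
           (\<lambda>x. Re (ell2_inner (basis_vec x) (P (basis_vec x)))) summable_on S)}"

definition ketbra :: "'a set \<Rightarrow> ('a \<Rightarrow> complex) \<Rightarrow> 'a operator" where
  "ketbra S \<xi> = (\<lambda>f\<in>ell2 S. \<lambda>x. ell2_inner \<xi> f * \<xi> x)"

interpretation cfun: vector_space "\<lambda>(c::complex) (f :: 'a \<Rightarrow> complex) x. c * f x"
  by unfold_locales (auto simp: fun_eq_iff algebra_simps)

definition eigenspace :: "'a set \<Rightarrow> 'a operator \<Rightarrow> complex \<Rightarrow> ('a \<Rightarrow> complex) set" where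
  "eigenspace S A \<mu> = {f \<in> ell2 S. A f = (\<lambda>x. \<mu> * f x)}"

text \<open>
  The von Neumann entropy. Its argument is meant to be a state, which has only real eigenvalues
  and whose nonzero eigenvalues have finite multiplicity. The sum runs over the distinct
  eigenvalues, each weighted with its multiplicity, and may be infinite. The eigenvalue 0
  contributes 0, because \<open>0 * ln 0 = 0\<close>.
\<close>

definition vN_entropy :: "'a set \<Rightarrow> 'a operator \<Rightarrow> ereal" where
  "vN_entropy S \<rho> =
     (\<Sum>\<^sub>\<infinity>\<mu>\<in>{\<mu>::real. eigenspace S \<rho> (complex_of_real \<mu>) \<noteq> {\<lambda>_. 0}}.
        ereal (real (cfun.dim (eigenspace S \<rho> (complex_of_real \<mu>))) * (- (\<mu> * ln \<mu>))))"


section \<open>Tensor powers\<close>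

text \<open>
  The set \<open>tuples S k\<close> is the power \<open>S\<^sup>k\<close>, and \<open>\<ell>\<^sup>2(S\<^sup>k)\<close> is identified with the \<open>k\<close>-fold tensor
  power of \<open>\<ell>\<^sup>2(S)\<close> in such a way that \<open>tensor_vec S k f\<close> is \<open>f\<^sub>0 \<otimes> \<dots> \<otimes> f\<^sub>k\<^sub>-\<^sub>1\<close>.
\<close>

definition tuples :: "'a set \<Rightarrow> nat \<Rightarrow> (nat \<Rightarrow> 'a) set" where
  "tuples S k = {..<k} \<rightarrow>\<^sub>E S"

definition tensor_vec ::
  "'a set \<Rightarrow> nat \<Rightarrow> (nat \<Rightarrow> 'a \<Rightarrow> complex) \<Rightarrow> (nat \<Rightarrow> 'a) \<Rightarrow> complex" where
  "tensor_vec S k f = (\<lambda>x. if x \<in> tuples S k then \<Prod>j<k. f j (x j) else 0)"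

definition tensor_op :: "'a set \<Rightarrow> nat \<Rightarrow> (nat \<Rightarrow> 'a operator) \<Rightarrow> (nat \<Rightarrow> 'a) operator" where
  "tensor_op S k A =
     (THE T. bounded_op (tuples S k) T \<and>
        (\<forall>f. (\<forall>j<k. f j \<in> ell2 S) \<longrightarrow>
           T (tensor_vec S k f) = tensor_vec S k (\<lambda>j. A j (f j))))"


section \<open>Channels and minimum output entropy\<close>

type_synonym 'a channel = "'a operator \<Rightarrow> 'a operator"

definition mixed_unitary :: "'a set \<Rightarrow> 'i set \<Rightarrow> ('i \<Rightarrow> 'a operator) \<Rightarrow> 'a channel" where
  "mixed_unitary S I V =
     (\<lambda>\<rho>\<in>trace_class S. \<lambda>f\<in>ell2 S. \<lambda>x.
        1 / of_nat (card I) * (\<Sum>i\<in>I. V i (\<rho> (adjoint_op S (V i) f)) x))"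

text \<open>The \<open>k\<close>-th tensor power of \<open>mixed_unitary S I V\<close>. Here \<open>card (tuples I k) = card I ^ k\<close>.\<close>

definition mixed_unitary_power ::
  "'a set \<Rightarrow> 'i set \<Rightarrow> ('i \<Rightarrow> 'a operator) \<Rightarrow> nat \<Rightarrow> (nat \<Rightarrow> 'a) channel" where
  "mixed_unitary_power S I V k =
     mixed_unitary (tuples S k) (tuples I k) (\<lambda>i. tensor_op S k (\<lambda>j. V (i j)))"

definition min_output_entropy :: "'a set \<Rightarrow> 'a channel \<Rightarrow> ereal" where
  "min_output_entropy S \<Phi> =
     (INF \<xi>\<in>{\<xi>\<in>ell2 S. ell2_norm \<xi> = 1}. vN_entropy S (\<Phi> (ketbra S \<xi>)))"

definition left_translation :: "('a, 'b) monoid_scheme \<Rightarrow> 'a \<Rightarrow> 'a operator" where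
  "left_translation G g =
     (\<lambda>f\<in>ell2 (carrier G). \<lambda>x. if x \<in> carrier G then f (inv\<^bsub>G\<^esub> g \<otimes>\<^bsub>G\<^esub> x) else 0)"

definition free_unitary :: "nat \<Rightarrow> letter list operator" where
  "free_unitary i = left_translation free_group (free_gen i)"

definition free_channel :: "nat \<Rightarrow> letter list channel" where
  "free_channel N = mixed_unitary (carrier free_group) {..<N} free_unitary"

definition free_channel_power :: "nat \<Rightarrow> nat \<Rightarrow> (nat \<Rightarrow> letter list) channel" where
  "free_channel_power N k = mixed_unitary_power (carrier free_group) {..<N} free_unitary k"

text \<open>\<open>\<Psi> k\<close> is the \<open>k\<close>-th tensor power of a channel on \<open>\<ell>\<^sup>2(S)\<close>.\<close>

definition regularized_MOE :: "'a set \<Rightarrow> (nat \<Rightarrow> (nat \<Rightarrow> 'a) channel) \<Rightarrow> ereal" where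
  "regularized_MOE S \<Psi> =
     lim (\<lambda>k. ereal (1 / real k) * min_output_entropy (tuples S k) (\<Psi> k))"

end

theory Submission
  imports Defs
begin

text \<open>
  \<^bold>\<open>The lower bound.\<close> Write \<open>v\<^sub>i = U\<^sub>i \<xi>\<close> for \<open>i \<in> [N]\<^sup>k\<close>, where \<open>U\<^sub>i\<close> is the tensor product of the
  \<open>U\<^sub>i\<^sub>(\<^sub>l\<^sub>)\<close>. The output of the \<open>k\<close>-th power on \<open>\<xi>\<close> is the uniform mixture of the pure states \<open>v\<^sub>i\<close>. Its
  entropy is at least \<open>- ln p\<close>, where the purity \<open>p\<close> is \<open>N\<^sup>-\<^sup>2\<^sup>k \<Sum>\<^sub>i\<^sub>j |\<langle>v\<^sub>i, v\<^sub>j\<rangle>|\<^sup>2\<close>. The heart of the matter is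
  the estimate \<open>\<Sum>\<^sub>i\<^sub>j |\<langle>v\<^sub>i, v\<^sub>j\<rangle>|\<^sup>2 \<le> (N + 9)\<^sup>k\<close> (\<open>overlap_bound\<close>), a version of Haagerup's inequality for
  words of length two in a product of free groups. It yields
  \<open>k ln N - k ln (1 + 9/N)\<close>, which implies the stated bound because \<open>1 + x \<le> (1 + \<surd>x)\<^sup>2\<close>.

  For \<open>k = 1\<close>, write \<open>\<langle>v\<^sub>i, v\<^sub>j\<rangle>\<close> as the sum of \<open>cnj (\<xi> (g\<^sub>i\<^sup>-\<^sup>1x)) \<xi> (g\<^sub>j\<^sup>-\<^sup>1x)\<close> over reduced words \<open>x\<close>. If
  \<open>i \<noteq> j\<close>, split the words into those that begin with \<open>g\<^sub>i\<close>, those that begin with \<open>g\<^sub>j\<close>, and the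
  others. Splitting a square into three costs a factor 3. For each kind of word, Cauchy--Schwarz bounds
  the square by the sum of \<open>|\<xi> (g\<^sub>i\<^sup>-\<^sup>1x)|\<^sup>2 |\<xi> (g\<^sub>j\<^sup>-\<^sup>1y)|\<^sup>2\<close> over pairs \<open>(x, y)\<close> of words of that kind. The words
  \<open>g\<^sub>i\<^sup>-\<^sup>1x\<close> and \<open>g\<^sub>j\<^sup>-\<^sup>1y\<close> determine \<open>i\<close>, \<open>j\<close>, \<open>x\<close> and \<open>y\<close> (\<open>cancellation_recover\<close>), so that the sum
  over all \<open>i \<noteq> j\<close> is at most \<open>\<parallel>\<xi>\<parallel>\<^sup>4 = 1\<close>. The three kinds contribute \<open>3 \<sqdot> 3 = 9\<close>; the diagonal
  contributes \<open>N\<close>. This argument works coordinatewise, so for general \<open>k\<close> the constants multiply.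

  \<^bold>\<open>The regularized entropy.\<close> That the limit exists follows from Fekete's lemma
  (\<open>fekete_convergent\<close>), since entropies are nonnegative and the minimum output entropy is
  subadditive: on a product input the output is a product state, and entropy is additive for product
  states.

  \<^bold>\<open>Spectral theory.\<close> Entropy is defined through eigenspaces in \<open>\<ell>\<^sup>2\<close>. The outputs have finite rank, and
  for a finite sum \<open>\<Sum>\<^sub>i |v\<^sub>i\<rangle>\<langle>v\<^sub>i|\<close> an orthonormal family of eigenvectors is obtained by maximizing a
  quadratic form on the sphere of coefficient vectors (\<open>dyads_spectral_decomposition\<close>).
\<close>

section \<open>Square-summable functions\<close>

lemma ell2_iff:
  "f \<in> ell2 S \<longleftrightarrow> (\<forall>x. x \<notin> S \<longrightarrow> f x = 0) \<and> (\<lambda>x. (cmod (f x))\<^sup>2) summable_on UNIV"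
proof -
  have "(\<lambda>x. (cmod (f x))\<^sup>2) summable_on S \<longleftrightarrow> (\<lambda>x. (cmod (f x))\<^sup>2) summable_on UNIV"
    if "\<forall>x. x \<notin> S \<longrightarrow> f x = 0"
    by (rule summable_on_cong_neutral) (use that in auto)
  then show ?thesis by (auto simp: ell2_def)
qed

lemma ell2_outside: "f \<in> ell2 S \<Longrightarrow> x \<notin> S \<Longrightarrow> f x = 0"
  by (simp add: ell2_iff)

lemma ell2_summable: "f \<in> ell2 S \<Longrightarrow> (\<lambda>x. (cmod (f x))\<^sup>2) summable_on UNIV"
  by (simp add: ell2_iff)

lemma ell2_add:
  assumes "f \<in> ell2 S" "g \<in> ell2 S"
  shows "(\<lambda>x. f x + g x) \<in> ell2 S"
proof -
  have "(\<lambda>x. 2 * (cmod (f x))\<^sup>2 + 2 * (cmod (g x))\<^sup>2) summable_on UNIV"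
    using assms by (intro summable_on_add summable_on_cmult_right) (auto dest: ell2_summable)
  then have "(\<lambda>x. (cmod (f x + g x))\<^sup>2) summable_on UNIV"
  proof (rule summable_on_comparison_test)
    fix x
    have "(cmod (f x + g x))\<^sup>2 \<le> (cmod (f x) + cmod (g x))\<^sup>2"
      by (intro power_mono norm_triangle_ineq) auto
    also have "\<dots> \<le> 2 * (cmod (f x))\<^sup>2 + 2 * (cmod (g x))\<^sup>2"
      using zero_le_power2[of "cmod (f x) - cmod (g x)"] by (simp add: power2_sum power2_diff)
    finally show "(cmod (f x + g x))\<^sup>2 \<le> 2 * (cmod (f x))\<^sup>2 + 2 * (cmod (g x))\<^sup>2" .
  qed auto
  then show ?thesis using assms by (simp add: ell2_iff)
qed

lemma ell2_scale: "f \<in> ell2 S \<Longrightarrow> (\<lambda>x. c * f x) \<in> ell2 S"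
  by (auto simp: ell2_iff norm_mult power_mult_distrib intro: summable_on_cmult_right)

lemma ell2_zero: "(\<lambda>_. 0) \<in> ell2 S"
  by (simp add: ell2_iff)

lemma ell2_diff: "f \<in> ell2 S \<Longrightarrow> g \<in> ell2 S \<Longrightarrow> (\<lambda>x. f x - g x) \<in> ell2 S"
  using ell2_add[OF _ ell2_scale[of g S "-1"], of f] by simp

lemma ell2_sum:
  "(\<And>i. i \<in> I \<Longrightarrow> f i \<in> ell2 S) \<Longrightarrow> (\<lambda>x. \<Sum>i\<in>I. f i x) \<in> ell2 S"
  by (induction I rule: infinite_finite_induct) (auto intro: ell2_add ell2_zero)

lemma ell2_finite_support:
  assumes "finite E" "E \<subseteq> S" "\<And>x. x \<notin> E \<Longrightarrow> f x = 0"
  shows "f \<in> ell2 S"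
proof -
  have "(\<lambda>x. (cmod (f x))\<^sup>2) summable_on UNIV"
    by (rule finite_nonzero_values_imp_summable_on)
       (rule finite_subset[OF _ assms(1)], use assms(3) in auto)
  then show ?thesis using assms by (auto simp: ell2_iff)
qed

lemma basis_vec_ell2: "x \<in> S \<Longrightarrow> basis_vec x \<in> ell2 S"
  by (rule ell2_finite_support[of "{x}"]) (auto simp: basis_vec_def)

lemma ell2_inner_abs_summable:
  assumes "f \<in> ell2 S" "g \<in> ell2 S"
  shows "(\<lambda>x. cmod (cnj (f x) * g x)) summable_on UNIV"
proof -
  have "(\<lambda>x. (cmod (f x))\<^sup>2 + (cmod (g x))\<^sup>2) summable_on UNIV"
    using assms by (intro summable_on_add) (auto dest: ell2_summable)
  then show ?thesis
  proof (rule summable_on_comparison_test)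
    fix x
    have "cmod (cnj (f x) * g x) \<le> 2 * (cmod (f x) * cmod (g x))"
      by (simp add: norm_mult)
    also have "\<dots> \<le> (cmod (f x))\<^sup>2 + (cmod (g x))\<^sup>2"
      using zero_le_power2[of "cmod (f x) - cmod (g x)"] by (simp add: power2_diff)
    finally show "cmod (cnj (f x) * g x) \<le> (cmod (f x))\<^sup>2 + (cmod (g x))\<^sup>2" .
  qed auto
qed

lemma ell2_inner_summable:
  "f \<in> ell2 S \<Longrightarrow> g \<in> ell2 S \<Longrightarrow> (\<lambda>x. cnj (f x) * g x) summable_on UNIV"
  by (rule abs_summable_summable, rule ell2_inner_abs_summable)

lemma ell2_inner_add_right:
  assumes "f \<in> ell2 S" "g \<in> ell2 S" "h \<in> ell2 S"
  shows "ell2_inner f (\<lambda>x. g x + h x) = ell2_inner f g + ell2_inner f h"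
  using infsum_add[OF ell2_inner_summable[OF assms(1,2)] ell2_inner_summable[OF assms(1,3)]]
  by (simp add: ell2_inner_def algebra_simps)

lemma ell2_inner_scale_right: "ell2_inner f (\<lambda>x. c * g x) = c * ell2_inner f g"
  using infsum_cmult_right'[of c "\<lambda>x. cnj (f x) * g x" UNIV]
  by (simp add: ell2_inner_def mult.left_commute)

lemma ell2_inner_zero_right: "ell2_inner f (\<lambda>_. 0) = 0"
  by (simp add: ell2_inner_def)

lemma ell2_inner_cnj: "cnj (ell2_inner f g) = ell2_inner g f"
  by (simp add: ell2_inner_def infsum_cnj[symmetric] mult.commute del: infsum_cnj)

lemma ell2_inner_diff_right:
  assumes "f \<in> ell2 S" "g \<in> ell2 S" "h \<in> ell2 S"
  shows "ell2_inner f (\<lambda>x. g x - h x) = ell2_inner f g - ell2_inner f h"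
  using ell2_inner_add_right[OF assms(1,2) ell2_scale[OF assms(3), of "-1"]]
        ell2_inner_scale_right[of f "-1" h] by simp

lemma ell2_inner_sum_right:
  assumes "f \<in> ell2 S" "\<And>i. i \<in> I \<Longrightarrow> g i \<in> ell2 S"
  shows "ell2_inner f (\<lambda>x. \<Sum>i\<in>I. g i x) = (\<Sum>i\<in>I. ell2_inner f (g i))"
  using assms(2)
proof (induction I rule: infinite_finite_induct)
  case (insert i I)
  then show ?case
    using ell2_inner_add_right[OF assms(1), of "g i" "\<lambda>x. \<Sum>i\<in>I. g i x"]
    by (simp add: ell2_sum)
qed (auto simp: ell2_inner_zero_right)

lemma ell2_inner_sum_left:
  assumes "f \<in> ell2 S" "\<And>i. i \<in> I \<Longrightarrow> g i \<in> ell2 S"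
  shows "ell2_inner (\<lambda>x. \<Sum>i\<in>I. g i x) f = (\<Sum>i\<in>I. ell2_inner (g i) f)"
  using arg_cong[OF ell2_inner_sum_right[OF assms], where f = cnj] by (simp add: ell2_inner_cnj)

lemma ell2_inner_scale_left: "ell2_inner (\<lambda>x. c * f x) g = cnj c * ell2_inner f g"
  using arg_cong[OF ell2_inner_scale_right[of g c f], where f = cnj] by (simp add: ell2_inner_cnj)

lemma ell2_inner_diff_left:
  assumes "f \<in> ell2 S" "g \<in> ell2 S" "h \<in> ell2 S"
  shows "ell2_inner (\<lambda>x. g x - h x) f = ell2_inner g f - ell2_inner h f"
  using arg_cong[OF ell2_inner_diff_right[OF assms], where f = cnj] by (simp add: ell2_inner_cnj)

lemma ell2_inner_basis_left: "ell2_inner (basis_vec x) f = f x"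
proof -
  have "ell2_inner (basis_vec x) f = (\<Sum>\<^sub>\<infinity>y\<in>{x}. f y)"
    unfolding ell2_inner_def
    by (rule infsum_cong_neutral) (auto simp: basis_vec_def)
  then show ?thesis by simp
qed

lemma ell2_inner_basis_right: "ell2_inner f (basis_vec x) = cnj (f x)"
  using ell2_inner_cnj[of "basis_vec x" f] by (simp add: ell2_inner_basis_left)

lemma ell2_norm_sq: "(ell2_norm f)\<^sup>2 = (\<Sum>\<^sub>\<infinity>x. (cmod (f x))\<^sup>2)"
  by (simp add: ell2_norm_def infsum_nonneg)

lemma ell2_norm_nonneg [simp]: "0 \<le> ell2_norm f"
  by (simp add: ell2_norm_def infsum_nonneg)

lemma ell2_inner_self:
  assumes "f \<in> ell2 S"
  shows "ell2_inner f f = complex_of_real ((ell2_norm f)\<^sup>2)"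
proof -
  have "((\<lambda>x. complex_of_real ((cmod (f x))\<^sup>2)) has_sum complex_of_real ((ell2_norm f)\<^sup>2)) UNIV"
    unfolding ell2_norm_sq
    by (intro has_sum_of_real has_sum_infsum ell2_summable[OF assms])
  moreover have "complex_of_real ((cmod (f x))\<^sup>2) = cnj (f x) * f x" for x
    by (simp only: complex_norm_square mult.commute)
  ultimately show ?thesis
    unfolding ell2_inner_def by (simp add: infsumI)
qed

lemma cmod_le_ell2_norm:
  assumes "f \<in> ell2 S"
  shows "cmod (f x) \<le> ell2_norm f"
proof -
  have "(cmod (f x))\<^sup>2 \<le> (ell2_norm f)\<^sup>2"
    using finite_sum_le_infsum[OF ell2_summable[OF assms], of "{x}"] by (simp add: ell2_norm_sq)
  then show ?thesis by (rule power2_le_imp_le) simp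
qed

lemma ell2_norm_eq_0: "f \<in> ell2 S \<Longrightarrow> ell2_norm f = 0 \<Longrightarrow> f = (\<lambda>_. 0)"
  using cmod_le_ell2_norm[of f S] by fastforce

lemma ell2_eqI:
  assumes "g \<in> ell2 S" "h \<in> ell2 S" "\<And>f. f \<in> ell2 S \<Longrightarrow> ell2_inner f g = ell2_inner f h"
  shows "g = h"
proof
  fix x
  show "g x = h x"
  proof (cases "x \<in> S")
    case True
    then show ?thesis using assms(3)[OF basis_vec_ell2] by (simp add: ell2_inner_basis_left)
  qed (metis assms(1,2) ell2_outside)
qed

lemma ell2_norm_scale: "ell2_norm (\<lambda>x. c * f x) = cmod c * ell2_norm f"
proof -
  have "(ell2_norm (\<lambda>x. c * f x))\<^sup>2 = (cmod c * ell2_norm f)\<^sup>2"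
    unfolding power_mult_distrib ell2_norm_sq norm_mult
    by (simp add: infsum_cmult_right')
  then show ?thesis by (simp add: power2_eq_iff_nonneg)
qed

text \<open>Cauchy--Schwarz for a unit vector: \<open>\<parallel>f - \<langle>\<xi>, f\<rangle> \<xi>\<parallel>\<^sup>2 = \<parallel>f\<parallel>\<^sup>2 - \<bar>\<langle>\<xi>, f\<rangle>\<bar>\<^sup>2\<close> is nonnegative.\<close>

lemma cmod_ell2_inner_unit_le:
  assumes "\<xi> \<in> ell2 S" "f \<in> ell2 S" "ell2_norm \<xi> = 1"
  shows "cmod (ell2_inner \<xi> f) \<le> ell2_norm f"
proof -
  define c where "c = ell2_inner \<xi> f"
  define h where "h = (\<lambda>x. f x - c * \<xi> x)"
  have h: "h \<in> ell2 S" unfolding h_def by (intro ell2_diff ell2_scale assms)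
  have [simp]: "ell2_inner \<xi> \<xi> = 1" using ell2_inner_self[OF assms(1)] assms(3) by simp
  have a: "ell2_inner \<xi> h = 0"
    unfolding h_def
    by (simp add: ell2_inner_diff_right[OF assms(1,2) ell2_scale[OF assms(1)]]
        ell2_inner_scale_right c_def)
  have "ell2_inner h h = ell2_inner h f - c * ell2_inner h \<xi>"
    using ell2_inner_diff_right[OF h assms(2) ell2_scale[OF assms(1)], of c]
    by (simp add: ell2_inner_scale_right h_def)
  also have "ell2_inner h \<xi> = 0" using a ell2_inner_cnj[of \<xi> h] by simp
  also have "ell2_inner h f = ell2_inner f f - cnj c * c"
    unfolding h_def
    by (simp add: ell2_inner_diff_left[OF assms(2,2) ell2_scale[OF assms(1)]]
        ell2_inner_scale_left c_def)
  finally have "complex_of_real ((ell2_norm h)\<^sup>2) = complex_of_real ((ell2_norm f)\<^sup>2 - (cmod c)\<^sup>2)"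
    by (simp add: ell2_inner_self[OF assms(2)] ell2_inner_self[OF h] mult.commute[of "cnj c"]
        complex_norm_square[symmetric] del: of_real_power)
  then have "(ell2_norm h)\<^sup>2 = (ell2_norm f)\<^sup>2 - (cmod c)\<^sup>2"
    by (simp only: of_real_eq_iff)
  then have "(cmod c)\<^sup>2 \<le> (ell2_norm f)\<^sup>2"
    using zero_le_power2[of "ell2_norm h"] by linarith
  then show ?thesis by (simp add: c_def power2_le_iff_abs_le)
qed

text \<open>
  Functions of finite support are dense in \<open>\<ell>\<^sup>2\<close>, hence a bounded operator is determined by its
  values on the basis vectors.
\<close>

lemma ell2_truncation_small:
  assumes "f \<in> ell2 S" "e > 0"
  obtains E where "finite E" "E \<subseteq> S" "ell2_norm (\<lambda>x. if x \<in> E then 0 else f x) \<le> e"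
proof -
  let ?n = "\<lambda>x. (cmod (f x))\<^sup>2"
  have s: "?n summable_on S" using assms by (simp add: ell2_def)
  obtain E where E: "finite E" "E \<subseteq> S" "dist (sum ?n E) (infsum ?n S) \<le> e\<^sup>2"
    using infsum_finite_approximation[OF s, of "e\<^sup>2"] assms(2) by auto
  have "(ell2_norm (\<lambda>x. if x \<in> E then 0 else f x))\<^sup>2 = infsum ?n (S - E)"
    unfolding ell2_norm_sq
    by (rule infsum_cong_neutral) (use ell2_outside[OF assms(1)] in auto)
  also have "\<dots> = infsum ?n S - sum ?n E"
    using infsum_Un_disjoint[of ?n "S - E" E] E summable_on_subset_banach[OF s, of "S - E"]
    by (simp add: Un_absorb2 Int_commute)
  also have "\<dots> \<le> e\<^sup>2" using E(3) by (simp add: dist_real_def)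
  finally have "ell2_norm (\<lambda>x. if x \<in> E then 0 else f x) \<le> e"
    using assms(2) by (simp add: power2_le_iff_abs_le)
  with E that show thesis by blast
qed

lemma bounded_op_closed: "bounded_op S A \<Longrightarrow> f \<in> ell2 S \<Longrightarrow> A f \<in> ell2 S"
  by (auto simp: bounded_op_def)

lemma bounded_op_extensional: "bounded_op S A \<Longrightarrow> f \<notin> ell2 S \<Longrightarrow> A f = undefined"
  by (auto simp: bounded_op_def PiE_def extensional_def)

lemma bounded_op_add:
  "bounded_op S A \<Longrightarrow> f \<in> ell2 S \<Longrightarrow> g \<in> ell2 S \<Longrightarrow> A (\<lambda>x. f x + g x) = (\<lambda>x. A f x + A g x)"
  by (auto simp: bounded_op_def)

lemma bounded_op_scale: "bounded_op S A \<Longrightarrow> f \<in> ell2 S \<Longrightarrow> A (\<lambda>x. c * f x) = (\<lambda>x. c * A f x)"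
  by (auto simp: bounded_op_def)

lemma bounded_op_zero: "bounded_op S A \<Longrightarrow> A (\<lambda>_. 0) = (\<lambda>_. 0)"
  using bounded_op_scale[of S A "\<lambda>_. 0" 0] by (simp add: ell2_zero)

lemma bounded_op_finite_support_eq:
  assumes A: "bounded_op S A" and B: "bounded_op S B"
    and eq: "\<And>x. x \<in> S \<Longrightarrow> A (basis_vec x) = B (basis_vec x)"
    and E: "finite E" "E \<subseteq> S"
  shows "A (\<lambda>x. if x \<in> E then f x else 0) = B (\<lambda>x. if x \<in> E then f x else 0)"
  using E
proof (induction E)
  case empty
  then show ?case by (simp add: bounded_op_zero[OF A] bounded_op_zero[OF B])
next
  case (insert y E)
  let ?g = "\<lambda>x. if x \<in> E then f x else 0" and ?h = "\<lambda>x. f y * basis_vec y x"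
  have "(\<lambda>x. if x \<in> insert y E then f x else 0) = (\<lambda>x. ?g x + ?h x)"
    using insert.hyps by (auto simp: basis_vec_def)
  moreover have "?g \<in> ell2 S" by (rule ell2_finite_support[of E]) (use insert in auto)
  moreover have b: "basis_vec y \<in> ell2 S" using insert by (intro basis_vec_ell2) auto
  ultimately show ?case
    using insert eq[of y]
    by (simp add: bounded_op_add[OF A] bounded_op_add[OF B] ell2_scale
        bounded_op_scale[OF A b] bounded_op_scale[OF B b])
qed

lemma bounded_op_eqI:
  assumes A: "bounded_op S A" and B: "bounded_op S B"
    and eq: "\<And>x. x \<in> S \<Longrightarrow> A (basis_vec x) = B (basis_vec x)"
  shows "A = B"
proof
  fix f
  show "A f = B f"
  proof (cases "f \<in> ell2 S")
    case f: True
    obtain a b where a: "\<And>g. g \<in> ell2 S \<Longrightarrow> ell2_norm (A g) \<le> a * ell2_norm g"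
      and b: "\<And>g. g \<in> ell2 S \<Longrightarrow> ell2_norm (B g) \<le> b * ell2_norm g"
      using A B unfolding bounded_op_def by metis
    show ?thesis
    proof
      fix x
      have "cmod (A f x - B f x) \<le> 0 + d" if "d > 0" for d
      proof -
        define e where "e = d / (\<bar>a\<bar> + \<bar>b\<bar> + 1)"
        have "e > 0" using that by (simp add: e_def add_nonneg_pos)
        then obtain E where E: "finite E" "E \<subseteq> S" "ell2_norm (\<lambda>x. if x \<in> E then 0 else f x) \<le> e"
          using ell2_truncation_small[OF f] by metis
        define g h where "g = (\<lambda>x. if x \<in> E then 0 else f x)"
          and "h = (\<lambda>x. if x \<in> E then f x else 0)"
        have h: "h \<in> ell2 S" unfolding h_def by (rule ell2_finite_support[OF E(1,2)]) auto
        have "g = (\<lambda>x. f x - h x)" by (auto simp: g_def h_def)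
        then have g: "g \<in> ell2 S" using ell2_diff[OF f h] by simp
        have fgh: "f = (\<lambda>x. g x + h x)" by (auto simp: g_def h_def)
        have "A h = B h"
          unfolding h_def by (rule bounded_op_finite_support_eq[OF A B eq E(1,2)])
        moreover have "A f = (\<lambda>x. A g x + A h x)" "B f = (\<lambda>x. B g x + B h x)"
          using bounded_op_add[OF A g h] bounded_op_add[OF B g h] fgh by simp_all
        ultimately have "cmod (A f x - B f x) = cmod (A g x - B g x)" by simp
        also have "\<dots> \<le> ell2_norm (A g) + ell2_norm (B g)"
          by (intro order_trans[OF norm_triangle_ineq4] add_mono cmod_le_ell2_norm[of _ S]
              bounded_op_closed[OF A g] bounded_op_closed[OF B g])
        also have "\<dots> \<le> \<bar>a\<bar> * ell2_norm g + \<bar>b\<bar> * ell2_norm g"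
          by (intro add_mono order_trans[OF a[OF g]] order_trans[OF b[OF g]] mult_right_mono) auto
        also have "\<dots> \<le> (\<bar>a\<bar> + \<bar>b\<bar> + 1) * e"
          using E(3) by (subst distrib_right[symmetric], intro mult_mono) (auto simp: g_def)
        also have "\<dots> = 0 + d" by (simp add: e_def)
        finally show ?thesis .
      qed
      then have "cmod (A f x - B f x) \<le> 0" by (rule field_le_epsilon)
      then show "A f x = B f x" by simp
    qed
  qed (simp add: bounded_op_extensional[OF A] bounded_op_extensional[OF B])
qed

text \<open>
  The adjoint is defined by a definite description. There is at most one candidate because an
  operator is determined on \<open>\<ell>\<^sup>2(S)\<close> by its inner products and is undefined elsewhere.
\<close>

lemma adjoint_op_eqI:
  assumes B: "bounded_op S B"
    and adj: "\<And>f g. f \<in> ell2 S \<Longrightarrow> g \<in> ell2 S \<Longrightarrow> ell2_inner (A f) g = ell2_inner f (B g)"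
  shows "adjoint_op S A = B"
  unfolding adjoint_op_def
proof (rule the_equality)
  fix C
  assume C: "bounded_op S C \<and> (\<forall>f\<in>ell2 S. \<forall>g\<in>ell2 S. ell2_inner (A f) g = ell2_inner f (C g))"
  show "C = B"
  proof
    fix g
    show "C g = B g"
    proof (cases "g \<in> ell2 S")
      case True
      then show ?thesis
        using adj C B by (intro ell2_eqI[of _ S]) (auto intro: bounded_op_closed)
    qed (use C B bounded_op_extensional in metis)
  qed
qed (use assms in auto)

section \<open>Permutation operators and the channels they generate\<close>

definition perm_vec :: "'a set \<Rightarrow> ('a \<Rightarrow> 'a) \<Rightarrow> ('a \<Rightarrow> complex) \<Rightarrow> 'a \<Rightarrow> complex" where
  "perm_vec S \<sigma> f = (\<lambda>x. if x \<in> S then f (\<sigma> x) else 0)"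

definition perm_op :: "'a set \<Rightarrow> ('a \<Rightarrow> 'a) \<Rightarrow> 'a operator" where
  "perm_op S \<sigma> = (\<lambda>f\<in>ell2 S. perm_vec S \<sigma> f)"

lemma perm_vec_ell2: "bij_betw \<sigma> S S \<Longrightarrow> f \<in> ell2 S \<Longrightarrow> perm_vec S \<sigma> f \<in> ell2 S"
  using summable_on_reindex_bij_betw[of \<sigma> S S "\<lambda>x. (cmod (f x))\<^sup>2"]
  by (auto simp: ell2_def perm_vec_def cong: summable_on_cong)

lemma ell2_inner_perm_vec:
  assumes "bij_betw \<sigma> S S"
  shows "ell2_inner (perm_vec S \<sigma> f) g = ell2_inner f (perm_vec S (inv_into S \<sigma>) g)"
proof -
  have "ell2_inner (perm_vec S \<sigma> f) g = (\<Sum>\<^sub>\<infinity>x\<in>S. cnj (f (\<sigma> x)) * g (inv_into S \<sigma> (\<sigma> x)))"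
    unfolding ell2_inner_def
    by (rule infsum_cong_neutral) (use assms in \<open>auto simp: perm_vec_def bij_betw_inv_into_left\<close>)
  also have "\<dots> = (\<Sum>\<^sub>\<infinity>y\<in>S. cnj (f y) * g (inv_into S \<sigma> y))"
    by (rule infsum_reindex_bij_betw[OF assms, of "\<lambda>y. cnj (f y) * g (inv_into S \<sigma> y)"])
  also have "\<dots> = ell2_inner f (perm_vec S (inv_into S \<sigma>) g)"
    unfolding ell2_inner_def by (rule infsum_cong_neutral) (auto simp: perm_vec_def)
  finally show ?thesis .
qed

lemma ell2_norm_perm_vec:
  assumes "bij_betw \<sigma> S S" "f \<in> ell2 S"
  shows "ell2_norm (perm_vec S \<sigma> f) = ell2_norm f"
proof -
  have "(\<Sum>\<^sub>\<infinity>x. (cmod (perm_vec S \<sigma> f x))\<^sup>2) = (\<Sum>\<^sub>\<infinity>x\<in>S. (cmod (f (\<sigma> x)))\<^sup>2)"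
    by (rule infsum_cong_neutral) (auto simp: perm_vec_def)
  also have "\<dots> = (\<Sum>\<^sub>\<infinity>x\<in>S. (cmod (f x))\<^sup>2)"
    by (rule infsum_reindex_bij_betw[OF assms(1), of "\<lambda>x. (cmod (f x))\<^sup>2"])
  also have "\<dots> = (\<Sum>\<^sub>\<infinity>x. (cmod (f x))\<^sup>2)"
    by (rule infsum_cong_neutral) (use ell2_outside[OF assms(2)] in auto)
  finally show ?thesis by (simp add: ell2_norm_def)
qed

lemma bounded_perm_op:
  assumes "bij_betw \<sigma> S S"
  shows "bounded_op S (perm_op S \<sigma>)"
  unfolding bounded_op_def
proof (intro conjI ballI allI exI[of _ 1])
  show "perm_op S \<sigma> \<in> ell2 S \<rightarrow>\<^sub>E ell2 S"
    using perm_vec_ell2[OF assms] by (auto simp: perm_op_def)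
next
  fix f g assume "f \<in> ell2 S" "g \<in> ell2 S"
  then show "perm_op S \<sigma> (\<lambda>x. f x + g x) = (\<lambda>x. perm_op S \<sigma> f x + perm_op S \<sigma> g x)"
    by (auto simp: perm_op_def ell2_add perm_vec_def)
next
  fix c f assume "f \<in> ell2 S"
  then show "perm_op S \<sigma> (\<lambda>x. c * f x) = (\<lambda>x. c * perm_op S \<sigma> f x)"
    by (auto simp: perm_op_def ell2_scale perm_vec_def)
next
  fix f assume "f \<in> ell2 S"
  then show "ell2_norm (perm_op S \<sigma> f) \<le> 1 * ell2_norm f"
    by (simp add: perm_op_def ell2_norm_perm_vec[OF assms])
qed

lemma adjoint_perm_op:
  assumes "bij_betw \<sigma> S S"
  shows "adjoint_op S (perm_op S \<sigma>) = perm_op S (inv_into S \<sigma>)"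
  by (rule adjoint_op_eqI)
     (use assms in \<open>auto simp: perm_op_def ell2_inner_perm_vec
        intro: bounded_perm_op[unfolded perm_op_def] bij_betw_inv_into\<close>)

definition tuple_map :: "nat \<Rightarrow> (nat \<Rightarrow> 'a \<Rightarrow> 'a) \<Rightarrow> (nat \<Rightarrow> 'a) \<Rightarrow> nat \<Rightarrow> 'a" where
  "tuple_map k \<sigma> x = (\<lambda>j\<in>{..<k}. \<sigma> j (x j))"

lemma bij_betw_tuple_map:
  assumes "\<And>j. j < k \<Longrightarrow> bij_betw (\<sigma> j) S S"
  shows "bij_betw (tuple_map k \<sigma>) (tuples S k) (tuples S k)"
proof (rule bij_betw_byWitness[where f' = "tuple_map k (\<lambda>j. inv_into S (\<sigma> j))"])
  show "\<forall>x\<in>tuples S k. tuple_map k (\<lambda>j. inv_into S (\<sigma> j)) (tuple_map k \<sigma> x) = x"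
    using bij_betw_inv_into_left[OF assms]
    by (auto simp: tuple_map_def tuples_def PiE_def Pi_def extensional_def fun_eq_iff)
  show "\<forall>x\<in>tuples S k. tuple_map k \<sigma> (tuple_map k (\<lambda>j. inv_into S (\<sigma> j)) x) = x"
    using bij_betw_inv_into_right[OF assms]
    by (auto simp: tuple_map_def tuples_def PiE_def Pi_def extensional_def fun_eq_iff)
  show "tuple_map k \<sigma> ` tuples S k \<subseteq> tuples S k"
    using bij_betwE[OF assms] by (auto simp: tuple_map_def tuples_def PiE_iff)
  show "tuple_map k (\<lambda>j. inv_into S (\<sigma> j)) ` tuples S k \<subseteq> tuples S k"
    using bij_betwE[OF bij_betw_inv_into[OF assms]] by (auto simp: tuple_map_def tuples_def PiE_iff)
qed

lemma tuple_map_closed: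
  assumes "\<And>j. j < k \<Longrightarrow> bij_betw (\<sigma> j) S S" "x \<in> tuples S k"
  shows "tuple_map k \<sigma> x \<in> tuples S k"
  using bij_betwE[OF bij_betw_tuple_map[of k \<sigma> S]] assms by blast

lemma basis_vec_eq_tensor_vec:
  assumes "x \<in> tuples S k"
  shows "basis_vec x = tensor_vec S k (\<lambda>j. basis_vec (x j))"
proof
  fix y
  have "(\<Prod>j<k. basis_vec (x j) (y j)) = 0" if "y \<in> tuples S k" "y \<noteq> x"
  proof -
    have "\<exists>j<k. y j \<noteq> x j"
    proof (rule ccontr)
      assume "\<not> ?thesis"
      then have "y = x"
        using that(1) assms by (intro PiE_ext[of y "{..<k}" "\<lambda>_. S" x]) (auto simp: tuples_def)
      with that(2) show False by simp
    qed
    then obtain j where "j < k" "y j \<noteq> x j" by blast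
    then show ?thesis by (intro prod_zero) (auto simp: basis_vec_def)
  qed
  then show "basis_vec x y = tensor_vec S k (\<lambda>j. basis_vec (x j)) y"
    using assms by (auto simp: tensor_vec_def basis_vec_def)
qed

text \<open>
  The sum over a finite set of tuples is at most the sum over the box spanned by its coordinates,
  which factorizes. For \<open>\<ell>\<^sup>2\<close> this says that product vectors are square-summable.
\<close>

lemma prod_summable_on_PiE:
  fixes f :: "'i \<Rightarrow> 'a \<Rightarrow> real"
  assumes "finite I" and nonneg: "\<And>i x. i \<in> I \<Longrightarrow> 0 \<le> f i x"
    and sm: "\<And>i. i \<in> I \<Longrightarrow> f i summable_on B i"
  shows "(\<lambda>x. \<Prod>i\<in>I. f i (x i)) summable_on PiE I B"
proof (rule nonneg_bdd_above_summable_on)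
  show "bdd_above (sum (\<lambda>x. \<Prod>i\<in>I. f i (x i)) ` {P. P \<subseteq> PiE I B \<and> finite P})"
  proof (rule bdd_aboveI2)
    fix P assume "P \<in> {P. P \<subseteq> PiE I B \<and> finite P}"
    then have P: "P \<subseteq> PiE I B" "finite P" by auto
    let ?B = "\<lambda>i. (\<lambda>x. x i) ` P"
    have "(\<Sum>x\<in>P. \<Prod>i\<in>I. f i (x i)) \<le> (\<Sum>x\<in>PiE I ?B. \<Prod>i\<in>I. f i (x i))"
      by (rule sum_mono2)
         (use P assms(1) nonneg in \<open>auto intro!: finite_PiE prod_nonneg\<close>)
    also have "\<dots> = (\<Prod>i\<in>I. \<Sum>y\<in>?B i. f i y)"
      by (rule prod_sum_PiE[symmetric]) (use P assms(1) in auto)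
    also have "\<dots> \<le> (\<Prod>i\<in>I. infsum (f i) (B i))"
      by (rule prod_mono)
         (use P nonneg sm in \<open>auto intro!: sum_nonneg finite_sum_le_infsum\<close>)
    finally show "(\<Sum>x\<in>P. \<Prod>i\<in>I. f i (x i)) \<le> (\<Prod>i\<in>I. infsum (f i) (B i))" .
  qed
qed (use nonneg in \<open>auto intro: prod_nonneg\<close>)

lemma tensor_vec_ell2:
  assumes "\<And>j. j < k \<Longrightarrow> f j \<in> ell2 S"
  shows "tensor_vec S k f \<in> ell2 (tuples S k)"
proof -
  have "(\<lambda>x. \<Prod>j\<in>{..<k}. (cmod (f j (x j)))\<^sup>2) summable_on PiE {..<k} (\<lambda>_. S)"
    by (rule prod_summable_on_PiE) (use assms in \<open>auto simp: ell2_def\<close>)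
  then show ?thesis
    by (simp add: ell2_def tensor_vec_def prod_norm[symmetric] prod_power_distrib
        tuples_def cong: summable_on_cong)
qed

text \<open>
  The tensor product is characterized by its values on product vectors. These include the basis
  vectors, so the permutation of tuples that acts on each coordinate by itself is the only candidate.
\<close>

lemma tensor_perm_op:
  assumes \<sigma>: "\<And>j. j < k \<Longrightarrow> bij_betw (\<sigma> j) S S"
    and A: "\<And>j. j < k \<Longrightarrow> A j = perm_op S (\<sigma> j)"
  shows "tensor_op S k A = perm_op (tuples S k) (tuple_map k \<sigma>)"
    (is "_ = ?T")
  unfolding tensor_op_def
proof (rule the_equality)
  have bdd: "bounded_op (tuples S k) ?T"
    by (rule bounded_perm_op[OF bij_betw_tuple_map[OF \<sigma>]])
  have T_tensor: "?T (tensor_vec S k f) = tensor_vec S k (\<lambda>j. A j (f j))"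
    if f: "\<forall>j<k. f j \<in> ell2 S" for f
  proof
    have mem: "tensor_vec S k f \<in> ell2 (tuples S k)" using f by (intro tensor_vec_ell2) auto
    fix x
    have "(\<Prod>j<k. f j (tuple_map k \<sigma> x j)) = (\<Prod>j<k. A j (f j) (x j))"
      if "x \<in> tuples S k"
      by (rule prod.cong)
         (use f that A in \<open>auto simp: perm_op_def perm_vec_def tuple_map_def tuples_def\<close>)
    then show "?T (tensor_vec S k f) x = tensor_vec S k (\<lambda>j. A j (f j)) x"
      using mem tuple_map_closed[OF \<sigma>] by (simp add: perm_op_def perm_vec_def tensor_vec_def)
  qed
  show "bounded_op (tuples S k) ?T \<and>
      (\<forall>f. (\<forall>j<k. f j \<in> ell2 S) \<longrightarrow>
        ?T (tensor_vec S k f) = tensor_vec S k (\<lambda>j. A j (f j)))"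
    using bdd T_tensor by blast
  fix T
  assume T: "bounded_op (tuples S k) T \<and>
      (\<forall>f. (\<forall>j<k. f j \<in> ell2 S) \<longrightarrow>
        T (tensor_vec S k f) = tensor_vec S k (\<lambda>j. A j (f j)))"
  show "T = ?T"
  proof (rule bounded_op_eqI)
    fix x assume x: "x \<in> tuples S k"
    then have f: "\<forall>j<k. basis_vec (x j) \<in> ell2 S"
      by (auto simp: tuples_def intro: basis_vec_ell2)
    show "T (basis_vec x) = ?T (basis_vec x)"
      unfolding basis_vec_eq_tensor_vec[OF x] using T T_tensor[OF f] f by simp
  qed (use T bdd in auto)
qed

lemma bounded_ketbra:
  assumes "\<xi> \<in> ell2 S" "ell2_norm \<xi> = 1"
  shows "bounded_op S (ketbra S \<xi>)"
  unfolding bounded_op_def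
proof (intro conjI ballI allI exI[of _ 1])
  show "ketbra S \<xi> \<in> ell2 S \<rightarrow>\<^sub>E ell2 S"
    using assms by (auto simp: ketbra_def ell2_scale)
next
  fix f g assume "f \<in> ell2 S" "g \<in> ell2 S"
  then show "ketbra S \<xi> (\<lambda>x. f x + g x) = (\<lambda>x. ketbra S \<xi> f x + ketbra S \<xi> g x)"
    using assms by (auto simp: ketbra_def ell2_add ell2_inner_add_right algebra_simps)
next
  fix c f assume "f \<in> ell2 S"
  then show "ketbra S \<xi> (\<lambda>x. c * f x) = (\<lambda>x. c * ketbra S \<xi> f x)"
    by (auto simp: ketbra_def ell2_scale ell2_inner_scale_right)
next
  fix f assume "f \<in> ell2 S"
  then show "ell2_norm (ketbra S \<xi> f) \<le> 1 * ell2_norm f"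
    using cmod_ell2_inner_unit_le[OF assms(1) _ assms(2)] assms(2)
    by (simp add: ketbra_def ell2_norm_scale)
qed

text \<open>A rank-one projection is its own absolute value.\<close>

lemma ketbra_trace_class:
  assumes "\<xi> \<in> ell2 S" "ell2_norm \<xi> = 1"
  shows "ketbra S \<xi> \<in> trace_class S"
proof -
  let ?P = "ketbra S \<xi>"
  have bdd: "bounded_op S ?P" by (rule bounded_ketbra[OF assms])
  have form: "ell2_inner f (?P g) = ell2_inner \<xi> g * ell2_inner f \<xi>" if "g \<in> ell2 S" for f g
    using that by (simp add: ketbra_def ell2_inner_scale_right)
  have "adjoint_op S ?P = ?P"
  proof (rule adjoint_op_eqI[OF bdd])
    fix f g assume "f \<in> ell2 S" "g \<in> ell2 S"
    then show "ell2_inner (?P f) g = ell2_inner f (?P g)"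
      using ell2_inner_cnj[of \<xi> f]
      by (simp add: ketbra_def ell2_inner_scale_left ell2_inner_scale_right)
  qed
  moreover have "positive_op S ?P"
    unfolding positive_op_def
  proof (intro conjI ballI bdd)
    fix f assume "f \<in> ell2 S"
    then have "ell2_inner f (?P f) = complex_of_real ((cmod (ell2_inner \<xi> f))\<^sup>2)"
      using form[of f f] by (simp only: complex_norm_square ell2_inner_cnj)
    then show "ell2_inner f (?P f) \<in> \<real>" "0 \<le> Re (ell2_inner f (?P f))" by simp_all
  qed
  moreover have "(\<lambda>x. Re (ell2_inner (basis_vec x) (?P (basis_vec x)))) summable_on S"
  proof -
    have "Re (ell2_inner (basis_vec x) (?P (basis_vec x))) = (cmod (\<xi> x))\<^sup>2" if "x \<in> S" for x
    proof -
      have "ell2_inner (basis_vec x) (?P (basis_vec x)) = complex_of_real ((cmod (\<xi> x))\<^sup>2)"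
        using form[OF basis_vec_ell2[OF that], of "basis_vec x"]
        by (simp only: ell2_inner_basis_left ell2_inner_basis_right complex_norm_square mult.commute)
      then show ?thesis by simp
    qed
    then show ?thesis
      using assms(1) by (simp add: ell2_def cong: summable_on_cong)
  qed
  ultimately show ?thesis
    using bdd by (auto simp: trace_class_def intro!: exI[of _ ?P])
qed

text \<open>In physicists' notation this is \<open>\<Sum>\<^sub>a c\<^sub>a |v\<^sub>a\<rangle>\<langle>v\<^sub>a|\<close>; the \<open>v\<^sub>a\<close> may be linearly dependent.\<close>

definition dyads :: "'a set \<Rightarrow> 'i set \<Rightarrow> ('i \<Rightarrow> real) \<Rightarrow> ('i \<Rightarrow> 'a \<Rightarrow> complex) \<Rightarrow> 'a operator" where
  "dyads S J c v =
     (\<lambda>f\<in>ell2 S. \<lambda>x. \<Sum>a\<in>J. complex_of_real (c a) * ell2_inner (v a) f * v a x)"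

text \<open>
  Each summand of the output is \<open>V |\<xi>\<rangle>\<langle>\<xi>| V\<^sup>* = |V\<xi>\<rangle>\<langle>V\<xi>|\<close>, so the output has rank at most \<open>|I|\<close>.
\<close>

lemma mixed_perm_output:
  assumes \<sigma>: "\<And>i. i \<in> I \<Longrightarrow> bij_betw (\<sigma> i) S S" and \<xi>: "\<xi> \<in> ell2 S" "ell2_norm \<xi> = 1"
    and V: "\<And>i. i \<in> I \<Longrightarrow> V i = perm_op S (\<sigma> i)"
  shows "mixed_unitary S I V (ketbra S \<xi>)
    = dyads S I (\<lambda>_. 1 / real (card I)) (\<lambda>i. perm_vec S (\<sigma> i) \<xi>)"
proof -
  have "V i (ketbra S \<xi> (adjoint_op S (V i) f)) x =
      ell2_inner (perm_vec S (\<sigma> i) \<xi>) f * perm_vec S (\<sigma> i) \<xi> x"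
    if i: "i \<in> I" and f: "f \<in> ell2 S" for i f x
  proof -
    have "perm_vec S (inv_into S (\<sigma> i)) f \<in> ell2 S"
      by (rule perm_vec_ell2[OF bij_betw_inv_into[OF \<sigma>[OF i]] f])
    then show ?thesis
      unfolding V[OF i] adjoint_perm_op[OF \<sigma>[OF i]]
      by (simp add: perm_op_def f ketbra_def ell2_scale \<xi> ell2_inner_perm_vec[OF \<sigma>[OF i]])
         (simp add: perm_vec_def)
  qed
  then show ?thesis
    by (auto simp: mixed_unitary_def dyads_def ketbra_trace_class[OF \<xi>] fun_eq_iff
        sum_distrib_left mult.assoc intro!: sum.cong)
qed

lemma mixed_perm_power_output:
  assumes \<sigma>: "\<And>i. i \<in> I \<Longrightarrow> bij_betw (\<sigma> i) S S"
    and \<xi>: "\<xi> \<in> ell2 (tuples S k)" "ell2_norm \<xi> = 1"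
    and V: "\<And>i. i \<in> I \<Longrightarrow> V i = perm_op S (\<sigma> i)"
  shows "mixed_unitary_power S I V k (ketbra (tuples S k) \<xi>)
    = dyads (tuples S k) (tuples I k) (\<lambda>_. 1 / real (card I ^ k))
        (\<lambda>i. perm_vec (tuples S k) (tuple_map k (\<lambda>j. \<sigma> (i j))) \<xi>)"
proof -
  have "card (tuples I k) = card I ^ k" by (simp add: tuples_def card_PiE)
  moreover have "tensor_op S k (\<lambda>j. V (i j)) = perm_op (tuples S k) (tuple_map k (\<lambda>j. \<sigma> (i j)))"
    if "i \<in> tuples I k" for i
    by (rule tensor_perm_op) (use that \<sigma> V in \<open>auto simp: tuples_def\<close>)
  moreover have "bij_betw (tuple_map k (\<lambda>j. \<sigma> (i j))) (tuples S k) (tuples S k)"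
    if "i \<in> tuples I k" for i
    by (rule bij_betw_tuple_map) (use that \<sigma> in \<open>auto simp: tuples_def\<close>)
  ultimately show ?thesis
    unfolding mixed_unitary_power_def by (subst mixed_perm_output[OF _ \<xi>]) auto
qed

section \<open>Spectral decomposition of positive finite-rank operators\<close>

lemma sum_fun_apply: "(\<Sum>a\<in>A. f a) x = (\<Sum>a\<in>A. f a x)"
  for f :: "'i \<Rightarrow> 'a \<Rightarrow> complex"
  by (induction A rule: infinite_finite_induct) auto

lemma ell2_norm_add_sq:
  assumes "f \<in> ell2 S" "g \<in> ell2 S"
  shows "(ell2_norm (\<lambda>x. f x + g x))\<^sup>2
    = (ell2_norm f)\<^sup>2 + (ell2_norm g)\<^sup>2 + 2 * Re (ell2_inner g f)"
proof -
  let ?h = "\<lambda>x. f x + g x"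
  have h: "?h \<in> ell2 S" by (rule ell2_add[OF assms])
  have "ell2_inner ?h ?h = ell2_inner ?h f + ell2_inner ?h g"
    by (rule ell2_inner_add_right[OF h assms])
  also have "ell2_inner ?h f = cnj (ell2_inner f f + ell2_inner f g)"
    by (simp only: ell2_inner_add_right[OF assms(1,1,2), symmetric] ell2_inner_cnj)
  also have "ell2_inner ?h g = cnj (ell2_inner g f + ell2_inner g g)"
    by (simp only: ell2_inner_add_right[OF assms(2,1,2), symmetric] ell2_inner_cnj)
  finally have "complex_of_real ((ell2_norm ?h)\<^sup>2)
      = cnj (complex_of_real ((ell2_norm f)\<^sup>2) + ell2_inner f g)
        + cnj (ell2_inner g f + complex_of_real ((ell2_norm g)\<^sup>2))"
    by (simp only: ell2_inner_self[OF h] ell2_inner_self[OF assms(1)] ell2_inner_self[OF assms(2)])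
  from arg_cong[OF this, where f = Re] show ?thesis
    by (simp add: ell2_inner_cnj[of g f, symmetric])
qed

text \<open>
  A quadratic polynomial that is nonnegative everywhere and vanishes at 0 has no linear term. Testing
  it at \<open>t = - a / (\<bar>b\<bar> + 1)\<close> suffices.
\<close>

lemma linear_coefficient_zero:
  fixes a b :: real
  assumes nonneg: "\<And>t. 0 \<le> 2 * t * a + t\<^sup>2 * b" and "a \<ge> 0"
  shows "a = 0"
proof (rule ccontr)
  assume "a \<noteq> 0"
  with assms have a: "a > 0" by simp
  let ?d = "\<bar>b\<bar> + 1"
  have d: "?d > 0" by linarith
  have "(- a / ?d)\<^sup>2 * b = a * (a / ?d) * (b / ?d)"
    by (simp add: power2_eq_square)
  also have "\<dots> \<le> a * (a / ?d) * 1"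
    using a d by (intro mult_left_mono) (auto simp: divide_le_eq)
  finally have "0 \<le> 2 * (- a / ?d) * a + a * (a / ?d)"
    using nonneg[of "- a / ?d"] by linarith
  also have "\<dots> = - (a * (a / ?d))" by simp
  finally have "a * (a / ?d) \<le> 0" by simp
  moreover have "a * (a / ?d) > 0" using a d by (intro mult_pos_pos divide_pos_pos)
  ultimately show False by simp
qed

text \<open>
  The coefficients vanish off the finite set \<open>J\<close>, so this sphere lies in a product of discs, which
  is compact by Tychonoff's theorem.
\<close>

lemma compact_coefficient_sphere:
  assumes "finite J"
  shows "compact {c :: 'i \<Rightarrow> complex. (\<forall>i. i \<notin> J \<longrightarrow> c i = 0) \<and> (\<Sum>i\<in>J. (cmod (c i))\<^sup>2) = 1}"
proof -
  let ?B = "\<lambda>i. if i \<in> J then cball (0 :: complex) 1 else {0}"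
  let ?Q = "{c :: 'i \<Rightarrow> complex. (\<Sum>i\<in>J. (cmod (c i))\<^sup>2) = 1}"
  have "compactin (product_topology (\<lambda>_. euclidean) UNIV) (PiE UNIV ?B)"
    unfolding compactin_PiE by auto
  then have "compact (PiE UNIV ?B)" by (simp add: euclidean_product_topology)
  moreover have "closed ?Q"
    by (intro closed_Collect_eq continuous_intros continuous_on_product_coordinates)
  ultimately have "compact (PiE UNIV ?B \<inter> ?Q)" by (rule compact_Int_closed)
  also have "PiE UNIV ?B \<inter> ?Q
      = {c. (\<forall>i. i \<notin> J \<longrightarrow> c i = 0) \<and> (\<Sum>i\<in>J. (cmod (c i))\<^sup>2) = 1}"
  proof -
    have "cmod (c i) \<le> 1" if "i \<in> J" "(\<Sum>i\<in>J. (cmod (c i))\<^sup>2) = 1" for c :: "'i \<Rightarrow> complex" and i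
      using member_le_sum[OF that(1), of "\<lambda>i. (cmod (c i))\<^sup>2"] assms that(2)
      by (simp add: abs_square_le_1)
    then show ?thesis by (auto simp: PiE_iff split: if_splits)
  qed
  finally show ?thesis .
qed

text \<open>
  A maximizer \<open>c\<close> of \<open>\<parallel>\<Sum>\<^sub>i c\<^sub>i v\<^sub>i\<parallel>\<^sup>2\<close> on the unit sphere, with maximum \<open>M\<close>, makes the nonnegative
  function \<open>M \<Sum>\<^sub>i |c\<^sub>i|\<^sup>2 - \<parallel>\<Sum>\<^sub>i c\<^sub>i v\<^sub>i\<parallel>\<^sup>2\<close> of \<open>c\<close> vanish. Varying one coordinate of \<open>c\<close> shows that
  the derivative vanishes as well, i.e. that \<open>c\<close> is an eigenvector of the Gram matrix.
\<close>

lemma dyad_sum_has_eigenvector: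
  fixes v :: "'i \<Rightarrow> 'a \<Rightarrow> complex"
  assumes J: "finite J" and v: "\<And>i. i \<in> J \<Longrightarrow> v i \<in> ell2 S"
    and i0: "i0 \<in> J" "v i0 \<noteq> (\<lambda>_. 0)"
  obtains c M w where "M > 0" "w = (\<lambda>x. \<Sum>i\<in>J. c i * v i x)" "w \<noteq> (\<lambda>_. 0)"
    "\<forall>i\<in>J. ell2_inner (v i) w = complex_of_real M * c i"
proof -
  define W where "W = (\<lambda>(c :: 'i \<Rightarrow> complex) x. \<Sum>i\<in>J. c i * v i x)"
  define nrm where "nrm = (\<lambda>c :: 'i \<Rightarrow> complex. \<Sum>i\<in>J. (cmod (c i))\<^sup>2)"
  define K where "K = {c :: 'i \<Rightarrow> complex. (\<forall>i. i \<notin> J \<longrightarrow> c i = 0) \<and> nrm c = 1}"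
  have W: "W c \<in> ell2 S" for c
    unfolding W_def by (intro ell2_sum ell2_scale v)
  have W_inner: "ell2_inner (W c) (W c) = (\<Sum>i\<in>J. \<Sum>j\<in>J. cnj (c i) * (c j * ell2_inner (v i) (v j)))"
    for c
  proof -
    have "ell2_inner (W c) (W c) = (\<Sum>i\<in>J. ell2_inner (\<lambda>x. c i * v i x) (W c))"
      by (subst (1) W_def) (intro ell2_inner_sum_left[where S = S] W ell2_scale v)
    also have "\<dots> = (\<Sum>i\<in>J. cnj (c i) * ell2_inner (v i) (W c))"
      by (simp only: ell2_inner_scale_left)
    also have "\<dots> = (\<Sum>i\<in>J. cnj (c i) * (\<Sum>j\<in>J. c j * ell2_inner (v i) (v j)))"
    proof (rule sum.cong[OF refl])
      fix i assume "i \<in> J"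
      have "ell2_inner (v i) (W c) = (\<Sum>j\<in>J. ell2_inner (v i) (\<lambda>x. c j * v j x))"
        unfolding W_def using \<open>i \<in> J\<close> by (intro ell2_inner_sum_right[where S = S] ell2_scale v) auto
      then show "cnj (c i) * ell2_inner (v i) (W c)
          = cnj (c i) * (\<Sum>j\<in>J. c j * ell2_inner (v i) (v j))"
        by (simp only: ell2_inner_scale_right)
    qed
    finally show ?thesis by (simp only: sum_distrib_left)
  qed
  have q_eq: "(ell2_norm (W c))\<^sup>2
      = Re (\<Sum>i\<in>J. \<Sum>j\<in>J. cnj (c i) * (c j * ell2_inner (v i) (v j)))" for c
    unfolding W_inner[symmetric] ell2_inner_self[OF W] by simp
  have cont: "continuous_on K (\<lambda>c. (ell2_norm (W c))\<^sup>2)"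
    unfolding q_eq
    by (intro continuous_intros continuous_on_subset[OF continuous_on_product_coordinates]) auto
  define c0 where "c0 = (\<lambda>i. if i = i0 then 1 else 0 :: complex)"
  have "nrm c0 = (\<Sum>i\<in>J. if i = i0 then 1 else 0)"
    unfolding nrm_def c0_def by (rule sum.cong) auto
  then have c0: "c0 \<in> K"
    using J i0(1) by (auto simp: K_def c0_def)
  have "compact K"
    unfolding K_def nrm_def by (rule compact_coefficient_sphere[OF J])
  then obtain c where c: "c \<in> K" and max: "\<And>d. d \<in> K \<Longrightarrow> (ell2_norm (W d))\<^sup>2 \<le> (ell2_norm (W c))\<^sup>2"
    using continuous_attains_sup[OF _ _ cont] c0 by blast
  define M where "M = (ell2_norm (W c))\<^sup>2"
  have "W c0 = v i0"
  proof
    fix x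
    have "W c0 x = (\<Sum>i\<in>J. if i = i0 then v i x else 0)"
      unfolding W_def c0_def by (rule sum.cong) auto
    then show "W c0 x = v i0 x" using J i0(1) by simp
  qed
  moreover have "ell2_norm (v i0) \<noteq> 0" using ell2_norm_eq_0[OF v[OF i0(1)]] i0(2) by blast
  ultimately have M: "M > 0"
    using max[OF c0] unfolding M_def
    by (metis ell2_norm_nonneg less_eq_real_def not_le order_less_le_trans zero_less_power)
  have homog: "(ell2_norm (W d))\<^sup>2 \<le> M * nrm d" if d: "\<forall>i. i \<notin> J \<longrightarrow> d i = 0" for d
  proof (cases "nrm d = 0")
    case True
    then have "\<forall>i\<in>J. d i = 0"
      using J by (simp add: nrm_def sum_nonneg_eq_0_iff)
    then have "W d = (\<lambda>_. 0)" by (simp add: W_def)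
    then show ?thesis using True by (simp add: ell2_norm_def)
  next
    case False
    have "nrm d \<ge> 0" by (simp add: nrm_def sum_nonneg)
    with False have pos: "nrm d > 0" by simp
    define s where "s = 1 / sqrt (nrm d)"
    have s: "s\<^sup>2 * nrm d = 1" using pos by (simp add: s_def power_divide)
    have "nrm (\<lambda>i. complex_of_real s * d i) = s\<^sup>2 * nrm d"
      by (simp add: nrm_def norm_mult power_mult_distrib sum_distrib_left)
    then have "(\<lambda>i. complex_of_real s * d i) \<in> K" using d s by (simp add: K_def)
    from max[OF this] have "(ell2_norm (W (\<lambda>i. complex_of_real s * d i)))\<^sup>2 \<le> M"
      by (simp add: M_def)
    moreover have "W (\<lambda>i. complex_of_real s * d i) = (\<lambda>x. complex_of_real s * W d x)"
      by (simp add: W_def sum_distrib_left mult.assoc)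
    ultimately have "s\<^sup>2 * (ell2_norm (W d))\<^sup>2 \<le> M"
      by (simp add: ell2_norm_scale power_mult_distrib)
    then have "s\<^sup>2 * (ell2_norm (W d))\<^sup>2 * nrm d \<le> M * nrm d"
      using pos by (intro mult_right_mono) auto
    also have "s\<^sup>2 * (ell2_norm (W d))\<^sup>2 * nrm d = (s\<^sup>2 * nrm d) * (ell2_norm (W d))\<^sup>2"
      by (simp only: mult_ac)
    finally show ?thesis using s by simp
  qed
  have eig: "ell2_inner (v i) (W c) = complex_of_real M * c i" if i: "i \<in> J" for i
  proof -
    \<comment> \<open>Perturbing the coordinate \<open>c\<^sub>i\<close> in the direction of the defect \<open>\<gamma>\<close> itself makes \<open>|\<gamma>|\<^sup>2\<close> the
      linear coefficient in \<open>t\<close>.\<close>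
    define \<gamma> where "\<gamma> = complex_of_real M * c i - ell2_inner (v i) (W c)"
    have "0 \<le> 2 * t * (cmod \<gamma>)\<^sup>2 + t\<^sup>2 * ((cmod \<gamma>)\<^sup>2 * (M - (ell2_norm (v i))\<^sup>2))" for t
    proof -
      define d where "d = c(i := c i + complex_of_real t * \<gamma>)"
      have d: "\<forall>j. j \<notin> J \<longrightarrow> d j = 0" using c i by (auto simp: d_def K_def)
      have split: "(\<Sum>j\<in>J. f j) = f i + (\<Sum>j\<in>J - {i}. f j)" for f :: "'i \<Rightarrow> 'z::comm_monoid_add"
        using sum.remove[OF J i] by blast
      have "W d = (\<lambda>x. W c x + (complex_of_real t * \<gamma>) * v i x)"
        by (auto simp: W_def split d_def algebra_simps intro!: sum.cong)
      then have "(ell2_norm (W d))\<^sup>2 = (ell2_norm (W c))\<^sup>2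
          + (cmod (complex_of_real t * \<gamma>) * ell2_norm (v i))\<^sup>2
          + 2 * Re (cnj (complex_of_real t * \<gamma>) * ell2_inner (v i) (W c))"
        using ell2_norm_add_sq[OF W ell2_scale[OF v[OF i]]]
        by (simp add: ell2_inner_scale_left ell2_norm_scale)
      then have L: "(ell2_norm (W d))\<^sup>2 = M + t\<^sup>2 * (cmod \<gamma>)\<^sup>2 * (ell2_norm (v i))\<^sup>2
          + 2 * t * Re (cnj \<gamma> * ell2_inner (v i) (W c))"
        by (simp add: M_def norm_mult power_mult_distrib mult.assoc)
      have "nrm d = (cmod (c i + complex_of_real t * \<gamma>))\<^sup>2 + (\<Sum>j\<in>J - {i}. (cmod (c j))\<^sup>2)"
        by (auto simp: nrm_def split d_def intro!: sum.cong)
      also have "(cmod (c i + complex_of_real t * \<gamma>))\<^sup>2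
          = (cmod (c i))\<^sup>2 + 2 * t * Re (cnj \<gamma> * c i) + t\<^sup>2 * (cmod \<gamma>)\<^sup>2"
        unfolding cmod_power2 by (simp add: power2_eq_square algebra_simps)
      finally have "nrm d = nrm c + 2 * t * Re (cnj \<gamma> * c i) + t\<^sup>2 * (cmod \<gamma>)\<^sup>2"
        by (simp add: nrm_def split)
      then have R: "nrm d = 1 + 2 * t * Re (cnj \<gamma> * c i) + t\<^sup>2 * (cmod \<gamma>)\<^sup>2"
        using c by (simp add: K_def)
      have "(cmod \<gamma>)\<^sup>2 = Re (cnj \<gamma> * \<gamma>)"
        unfolding cmod_power2 by (simp add: power2_eq_square)
      also have "\<dots> = M * Re (cnj \<gamma> * c i) - Re (cnj \<gamma> * ell2_inner (v i) (W c))"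
        by (subst (2) \<gamma>_def) (simp add: algebra_simps)
      finally have "2 * t * (cmod \<gamma>)\<^sup>2
          = 2 * t * (M * Re (cnj \<gamma> * c i) - Re (cnj \<gamma> * ell2_inner (v i) (W c)))"
        by (simp only:)
      then show ?thesis
        using homog[OF d] unfolding L R by (simp add: algebra_simps)
    qed
    then have "(cmod \<gamma>)\<^sup>2 = 0" by (rule linear_coefficient_zero) simp
    then show ?thesis by (simp add: \<gamma>_def)
  qed
  have "W c \<noteq> (\<lambda>_. 0)"
  proof
    assume "W c = (\<lambda>_. 0)"
    then have "M = 0" by (simp add: M_def ell2_norm_def)
    with M show False by simp
  qed
  with M eig show thesis by (intro that[of M "W c" c]) (auto simp: W_def)
qed

definition orthonormal :: "'a set \<Rightarrow> 'i set \<Rightarrow> ('i \<Rightarrow> 'a \<Rightarrow> complex) \<Rightarrow> bool" where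
  "orthonormal S J e \<longleftrightarrow> (\<forall>a\<in>J. e a \<in> ell2 S) \<and>
     (\<forall>a\<in>J. \<forall>b\<in>J. ell2_inner (e a) (e b) = (if a = b then 1 else 0))"

lemma orthonormal_ell2: "orthonormal S J e \<Longrightarrow> a \<in> J \<Longrightarrow> e a \<in> ell2 S"
  by (simp add: orthonormal_def)

lemma orthonormal_inner_sum:
  assumes "orthonormal S J e" "finite J" "b \<in> J"
  shows "ell2_inner (e b) (\<lambda>x. \<Sum>a\<in>J. c a * e a x) = c b"
proof -
  have "ell2_inner (e b) (\<lambda>x. \<Sum>a\<in>J. c a * e a x) = (\<Sum>a\<in>J. c a * ell2_inner (e b) (e a))"
    using assms by (subst ell2_inner_sum_right[where S = S]) (auto simp: ell2_scale ell2_inner_scale_right orthonormal_def)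
  also have "\<dots> = (\<Sum>a\<in>J. if a = b then c a else 0)"
    using assms by (intro sum.cong) (auto simp: orthonormal_def)
  finally show ?thesis using assms by simp
qed

lemma orthonormal_inj_on: "orthonormal S J e \<Longrightarrow> inj_on e J"
  unfolding inj_on_def orthonormal_def by (metis zero_neq_one)

lemma orthonormal_independent:
  assumes "orthonormal S J e" "finite J"
  shows "cfun.independent (e ` J)"
proof -
  have "u (e b) = 0" if z: "(\<Sum>f\<in>e ` J. (\<lambda>x. u f * f x)) = 0" and b: "b \<in> J" for u b
  proof -
    have "(\<Sum>a\<in>J. (\<lambda>x. u (e a) * e a x)) = 0"
      using z by (simp add: sum.reindex[OF orthonormal_inj_on[OF assms(1)]] o_def)
    then have "(\<lambda>x. \<Sum>a\<in>J. u (e a) * e a x) = (\<lambda>_. 0)"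
      by (auto simp: fun_eq_iff sum_fun_apply)
    then have "u (e b) = ell2_inner (e b) (\<lambda>_. 0)"
      using orthonormal_inner_sum[OF assms b, of "\<lambda>a. u (e a)"] by simp
    then show ?thesis by (simp add: ell2_inner_zero_right)
  qed
  then show ?thesis
    using assms(2) by (auto simp: cfun.dependent_finite)
qed

text \<open>
  An orthonormal family of eigenvectors of \<open>\<rho>\<close> that is maximal must span the range of \<open>\<rho>\<close>: otherwise
  the components of the \<open>v\<^sub>i\<close> orthogonal to it yield another eigenvector.
\<close>

theorem dyads_spectral_decomposition:
  fixes v :: "'i \<Rightarrow> 'a \<Rightarrow> complex"
  assumes J: "finite J" and v: "\<And>i. i \<in> J \<Longrightarrow> v i \<in> ell2 S" and r: "r > 0"
  obtains E \<mu> where "finite E" "orthonormal S E (\<lambda>e. e)" "\<And>e. e \<in> E \<Longrightarrow> \<mu> e > 0"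
    "dyads S J (\<lambda>_. r) v = dyads S E \<mu> (\<lambda>e. e)"
proof -
  define T where "T = (\<lambda>f x. \<Sum>i\<in>J. ell2_inner (v i) f * v i x)"
  have T_ell2: "T f \<in> ell2 S" for f unfolding T_def by (intro ell2_sum ell2_scale v)
  have T_sym: "ell2_inner f (T g) = ell2_inner (T f) g" if "f \<in> ell2 S" "g \<in> ell2 S" for f g
  proof -
    have "ell2_inner f (T g) = (\<Sum>i\<in>J. ell2_inner (v i) g * ell2_inner f (v i))"
      unfolding T_def using that v
      by (subst ell2_inner_sum_right[where S = S]) (auto simp: ell2_scale ell2_inner_scale_right)
    moreover have "ell2_inner (T f) g = (\<Sum>i\<in>J. cnj (ell2_inner (v i) f) * ell2_inner (v i) g)"
      unfolding T_def using that v
      by (subst ell2_inner_sum_left[where S = S]) (auto simp: ell2_scale ell2_inner_scale_left)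
    ultimately show ?thesis by (simp add: ell2_inner_cnj mult.commute)
  qed
  define P where "P = (\<lambda>E. finite E \<and> orthonormal S E (\<lambda>e. e) \<and>
      (\<forall>e\<in>E. \<exists>\<mu>>0. T e = (\<lambda>x. complex_of_real \<mu> * e x)))"
  \<comment> \<open>Eigenvectors for nonzero eigenvalues lie in the span of the \<open>v\<^sub>i\<close>, which bounds their number.\<close>
  have "card E \<le> card (v ` J)" if PE: "P E" for E
  proof -
    have "e \<in> cfun.span (v ` J)" if e: "e \<in> E" for e
    proof -
      obtain \<mu> where \<mu>: "\<mu> > 0" "T e = (\<lambda>x. complex_of_real \<mu> * e x)"
        using PE e unfolding P_def by blast
      have "e = (\<lambda>x. complex_of_real (1 / \<mu>) * T e x)" using \<mu> by (auto simp: fun_eq_iff)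
      also have "\<dots> = (\<Sum>i\<in>J. (\<lambda>x. complex_of_real (1 / \<mu>) * ell2_inner (v i) e * v i x))"
        by (auto simp: fun_eq_iff sum_fun_apply T_def sum_distrib_left mult.assoc intro!: sum.cong)
      also have "\<dots> \<in> cfun.span (v ` J)"
        by (intro cfun.span_sum cfun.span_scale cfun.span_base) auto
      finally show ?thesis .
    qed
    then show ?thesis
      using cfun.independent_span_bound[of "v ` J" E] J PE orthonormal_independent[of S E "\<lambda>e. e"]
      by (auto simp: P_def)
  qed
  then have bound: "\<forall>E. P E \<longrightarrow> card E < Suc (card (v ` J))" by (simp add: less_Suc_eq_le)
  have "P {}" by (simp add: P_def orthonormal_def)
  from ex_has_greatest_nat[where P = P and f = card, OF this bound]
  obtain E where E: "P E" and max: "\<And>F. P F \<Longrightarrow> card F \<le> card E"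
    by blast
  have fin: "finite E" and on: "orthonormal S E (\<lambda>e. e)" using E by (auto simp: P_def)
  obtain \<mu> where \<mu>: "\<And>e. e \<in> E \<Longrightarrow> \<mu> e > 0"
      "\<And>e. e \<in> E \<Longrightarrow> T e = (\<lambda>x. complex_of_real (\<mu> e) * e x)"
    using E unfolding P_def by metis
  define p where "p = (\<lambda>i x. \<Sum>e\<in>E. ell2_inner e (v i) * e x)"
  define w where "w = (\<lambda>i x. v i x - p i x)"
  have p: "p i \<in> ell2 S" for i
    unfolding p_def by (intro ell2_sum ell2_scale orthonormal_ell2[OF on])
  have w: "w i \<in> ell2 S" if "i \<in> J" for i
    unfolding w_def by (intro ell2_diff v p that)
  have e_w: "ell2_inner e (w i) = 0" if "e \<in> E" "i \<in> J" for e i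
  proof -
    have "ell2_inner e (p i) = ell2_inner e (v i)"
      unfolding p_def by (rule orthonormal_inner_sum[OF on fin that(1)])
    then show ?thesis
      using ell2_inner_diff_right[OF orthonormal_ell2[OF on that(1)] v[OF that(2)] p]
      by (simp add: w_def)
  qed
  have "w i = (\<lambda>_. 0)" if i: "i \<in> J" for i
  proof (rule ccontr)
    assume nz: "w i \<noteq> (\<lambda>_. 0)"
    obtain c M u where M: "M > 0" and u: "u = (\<lambda>x. \<Sum>i\<in>J. c i * w i x)" "u \<noteq> (\<lambda>_. 0)"
      and eig: "\<forall>i\<in>J. ell2_inner (w i) u = complex_of_real M * c i"
      by (rule dyad_sum_has_eigenvector[where v = w, OF J w i nz]) (assumption | rule that)+
    have u_ell2: "u \<in> ell2 S" unfolding u(1) by (intro ell2_sum ell2_scale w)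
    have e_u: "ell2_inner e u = 0" if e: "e \<in> E" for e
    proof -
      have "ell2_inner e u = (\<Sum>i\<in>J. c i * ell2_inner e (w i))"
        unfolding u(1) using orthonormal_ell2[OF on e] w
        by (subst ell2_inner_sum_right[where S = S]) (auto simp: ell2_scale ell2_inner_scale_right)
      then show ?thesis using e_w[OF e] by simp
    qed
    have p_u: "ell2_inner (p i) u = 0" for i
      unfolding p_def using u_ell2 orthonormal_ell2[OF on] e_u
      by (subst ell2_inner_sum_left[where S = S]) (auto simp: ell2_scale ell2_inner_scale_left)
    have v_u: "ell2_inner (v i) u = complex_of_real M * c i" if "i \<in> J" for i
      using ell2_inner_diff_left[OF u_ell2 v[OF that] p, of i] p_u[of i] eig that
      by (simp add: w_def)
    \<comment> \<open>The vector \<open>T u\<close> has no component along \<open>E\<close>, since \<open>T\<close> is symmetric and \<open>u\<close> is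
      orthogonal to the eigenvectors in \<open>E\<close>.\<close>
    have "(\<Sum>i\<in>J. ell2_inner (v i) u * p i x) = 0" for x
    proof -
      have "(\<Sum>i\<in>J. ell2_inner (v i) u * p i x)
          = (\<Sum>i\<in>J. \<Sum>e\<in>E. ell2_inner (v i) u * ell2_inner e (v i) * e x)"
        by (simp add: p_def sum_distrib_left mult.assoc)
      also have "\<dots> = (\<Sum>e\<in>E. \<Sum>i\<in>J. ell2_inner (v i) u * ell2_inner e (v i) * e x)"
        by (rule sum.swap)
      also have "\<dots> = (\<Sum>e\<in>E. ell2_inner e (T u) * e x)"
      proof (rule sum.cong[OF refl])
        fix e assume "e \<in> E"
        then show "(\<Sum>i\<in>J. ell2_inner (v i) u * ell2_inner e (v i) * e x) = ell2_inner e (T u) * e x"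
          unfolding T_def using orthonormal_ell2[OF on] v
          by (subst ell2_inner_sum_right[where S = S]) (auto simp: ell2_scale ell2_inner_scale_right sum_distrib_right)
      qed
      also have "\<dots> = 0"
      proof (rule sum.neutral, rule ballI)
        fix e assume e: "e \<in> E"
        have "ell2_inner e (T u) = ell2_inner (T e) u"
          by (rule T_sym[OF orthonormal_ell2[OF on e] u_ell2])
        then show "ell2_inner e (T u) * e x = 0"
          by (simp add: \<mu>(2)[OF e] ell2_inner_scale_left e_u[OF e])
      qed
      finally show ?thesis .
    qed
    moreover have "T u x = (\<Sum>i\<in>J. ell2_inner (v i) u * w i x) + (\<Sum>i\<in>J. ell2_inner (v i) u * p i x)" for x
      by (simp add: T_def w_def sum.distrib[symmetric] algebra_simps)
    ultimately have "T u x = (\<Sum>i\<in>J. ell2_inner (v i) u * w i x)" for x by simp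
    then have "T u x = (\<Sum>i\<in>J. complex_of_real M * c i * w i x)" for x
      by (simp add: v_u)
    moreover have "complex_of_real M * u x = (\<Sum>i\<in>J. complex_of_real M * c i * w i x)" for x
      by (simp add: u(1) sum_distrib_left mult.assoc)
    ultimately have Tu: "T u = (\<lambda>x. complex_of_real M * u x)" by (simp add: fun_eq_iff)
    define n where "n = ell2_norm u"
    have n: "n > 0"
      using ell2_norm_eq_0[OF u_ell2] u(2) ell2_norm_nonneg[of u] unfolding n_def by linarith
    define f where "f = (\<lambda>x. complex_of_real (1 / n) * u x)"
    have f_ell2: "f \<in> ell2 S" unfolding f_def by (rule ell2_scale[OF u_ell2])
    have "ell2_norm f = 1" unfolding f_def ell2_norm_scale using n by (simp add: n_def norm_divide)
    then have ff: "ell2_inner f f = 1" by (simp add: ell2_inner_self[OF f_ell2])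
    have ef: "ell2_inner e f = 0" if "e \<in> E" for e
      unfolding f_def ell2_inner_scale_right by (simp add: e_u[OF that])
    then have fe: "ell2_inner f e = 0" if "e \<in> E" for e
      using that ell2_inner_cnj[of e f] by simp
    have "f \<notin> E" using ef ff by auto
    have "T f = (\<lambda>x. complex_of_real M * f x)"
    proof
      fix x
      have "T f x = complex_of_real (1 / n) * T u x"
        unfolding T_def f_def ell2_inner_scale_right by (simp add: sum_distrib_left)
      then show "T f x = complex_of_real M * f x" by (simp add: Tu f_def)
    qed
    moreover have "orthonormal S (insert f E) (\<lambda>e. e)"
      using on f_ell2 ff ef fe \<open>f \<notin> E\<close> unfolding orthonormal_def by auto
    ultimately have "P (insert f E)"
      using E M by (auto simp: P_def)
    from max[OF this] show False using \<open>f \<notin> E\<close> fin by simp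
  qed
  then have v_eq: "v i x = p i x" if "i \<in> J" for i x
    using that by (auto simp: w_def fun_eq_iff)
  have "dyads S J (\<lambda>_. r) v = dyads S E (\<lambda>e. r * \<mu> e) (\<lambda>e. e)"
  proof
    fix f
    show "dyads S J (\<lambda>_. r) v f = dyads S E (\<lambda>e. r * \<mu> e) (\<lambda>e. e) f"
    proof (cases "f \<in> ell2 S")
      case f: True
      have "T f x = (\<Sum>e\<in>E. complex_of_real (\<mu> e) * ell2_inner e f * e x)" for x
      proof -
        have "T f x = (\<Sum>i\<in>J. \<Sum>e\<in>E. ell2_inner (v i) f * ell2_inner e (v i) * e x)"
          by (simp add: T_def v_eq) (simp add: p_def sum_distrib_left mult.assoc)
        also have "\<dots> = (\<Sum>e\<in>E. \<Sum>i\<in>J. ell2_inner (v i) f * ell2_inner e (v i) * e x)"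
          by (rule sum.swap)
        also have "\<dots> = (\<Sum>e\<in>E. ell2_inner e (T f) * e x)"
        proof (rule sum.cong[OF refl])
          fix e assume "e \<in> E"
          then show "(\<Sum>i\<in>J. ell2_inner (v i) f * ell2_inner e (v i) * e x) = ell2_inner e (T f) * e x"
            unfolding T_def using orthonormal_ell2[OF on] v
            by (subst ell2_inner_sum_right[where S = S]) (auto simp: ell2_scale ell2_inner_scale_right sum_distrib_right)
        qed
        also have "\<dots> = (\<Sum>e\<in>E. complex_of_real (\<mu> e) * ell2_inner e f * e x)"
        proof (rule sum.cong[OF refl])
          fix e assume e: "e \<in> E"
          have "ell2_inner e (T f) = ell2_inner (T e) f"
            by (rule T_sym[OF orthonormal_ell2[OF on e] f])
          then show "ell2_inner e (T f) * e x = complex_of_real (\<mu> e) * ell2_inner e f * e x"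
            by (simp add: \<mu>(2)[OF e] ell2_inner_scale_left)
        qed
        finally show ?thesis .
      qed
      then show ?thesis
        using f by (auto simp: dyads_def fun_eq_iff T_def sum_distrib_left[symmetric] mult.assoc)
    qed (simp add: dyads_def)
  qed
  with that[OF fin on, of "\<lambda>e. r * \<mu> e"] r \<mu>(1) show thesis by simp
qed

section \<open>Entropy, trace and purity of finite-rank states\<close>

lemma dyads_apply:
  "f \<in> ell2 S \<Longrightarrow>
    dyads S J c v f = (\<lambda>x. \<Sum>a\<in>J. complex_of_real (c a) * ell2_inner (v a) f * v a x)"
  by (simp add: dyads_def)

lemma inner_dyads:
  assumes "\<And>a. a \<in> J \<Longrightarrow> v a \<in> ell2 S" "f \<in> ell2 S" "g \<in> ell2 S"
  shows "ell2_inner g (dyads S J c v f)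
    = (\<Sum>a\<in>J. complex_of_real (c a) * ell2_inner (v a) f * ell2_inner g (v a))"
  unfolding dyads_apply[OF assms(2)] using assms(1,3)
  by (subst ell2_inner_sum_right[where S = S]) (auto simp: ell2_scale ell2_inner_scale_right)

text \<open>
  A finite-rank operator determines and is determined by its integral kernel
  \<open>K(x, y) = \<Sum>\<^sub>a c\<^sub>a v\<^sub>a(x) cnj(v\<^sub>a(y))\<close>, in spite of the many ways to write it as a sum of dyads. Hence
  trace and purity, which can be computed from any such sum, are the same for all of them.
\<close>

definition dyads_kernel :: "'i set \<Rightarrow> ('i \<Rightarrow> real) \<Rightarrow> ('i \<Rightarrow> 'a \<Rightarrow> complex) \<Rightarrow> 'a \<Rightarrow> 'a \<Rightarrow> complex" where
  "dyads_kernel J c v x y = (\<Sum>a\<in>J. complex_of_real (c a) * v a x * cnj (v a y))"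

lemma dyads_eq_imp_kernel_eq:
  assumes v: "\<And>a. a \<in> J \<Longrightarrow> v a \<in> ell2 S" and w: "\<And>a. a \<in> L \<Longrightarrow> w a \<in> ell2 S"
    and eq: "dyads S J c v = dyads S L d w"
  shows "dyads_kernel J c v x y = dyads_kernel L d w x y"
proof (cases "y \<in> S")
  case True
  have "dyads S J c v (basis_vec y) x = dyads_kernel J c v x y"
    "dyads S L d w (basis_vec y) x = dyads_kernel L d w x y"
    by (simp_all add: dyads_apply[OF basis_vec_ell2[OF True]] dyads_kernel_def
        ell2_inner_basis_right mult_ac)
  then show ?thesis using eq by simp
next
  case False
  then show ?thesis
    using ell2_outside[OF v] ell2_outside[OF w] by (simp add: dyads_kernel_def)
qed

lemma dyads_apply_kernel:
  assumes v: "\<And>a. a \<in> J \<Longrightarrow> v a \<in> ell2 S" and f: "f \<in> ell2 S"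
  shows "dyads S J c v f x = ell2_inner (\<lambda>y. cnj (dyads_kernel J c v x y)) f"
proof -
  have "ell2_inner (\<lambda>y. cnj (dyads_kernel J c v x y)) f
      = ell2_inner (\<lambda>y. \<Sum>a\<in>J. (complex_of_real (c a) * cnj (v a x)) * v a y) f"
    by (simp add: dyads_kernel_def)
  also have "\<dots> = (\<Sum>a\<in>J. complex_of_real (c a) * v a x * ell2_inner (v a) f)"
    using v f by (subst ell2_inner_sum_left[where S = S]) (auto simp: ell2_scale ell2_inner_scale_left)
  finally show ?thesis by (simp add: dyads_apply[OF f] mult_ac)
qed

lemma kernel_eq_imp_dyads_eq:
  assumes v: "\<And>a. a \<in> J \<Longrightarrow> v a \<in> ell2 S" and w: "\<And>a. a \<in> L \<Longrightarrow> w a \<in> ell2 S"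
    and eq: "\<And>x y. dyads_kernel J c v x y = dyads_kernel L d w x y"
  shows "dyads S J c v = dyads S L d w"
proof
  fix f
  show "dyads S J c v f = dyads S L d w f"
  proof (cases "f \<in> ell2 S")
    case f: True
    show ?thesis
      by (rule ext) (simp only: dyads_apply_kernel[where v = v, OF v f] dyads_apply_kernel[where v = w, OF w f] eq)
  qed (simp add: dyads_def)
qed

lemma dyads_kernel_diag:
  "complex_of_real (\<Sum>a\<in>J. c a * (cmod (v a x))\<^sup>2) = dyads_kernel J c v x x"
  unfolding dyads_kernel_def of_real_sum of_real_mult complex_norm_square by (simp only: mult.assoc)

lemma dyads_trace_has_sum:
  assumes "finite J" "\<And>a. a \<in> J \<Longrightarrow> v a \<in> ell2 S"
  shows "((\<lambda>x. \<Sum>a\<in>J. c a * (cmod (v a x))\<^sup>2) has_sum (\<Sum>a\<in>J. c a * (ell2_norm (v a))\<^sup>2)) UNIV"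
  using assms
proof (induction J)
  case (insert a J)
  have "((\<lambda>x. c a * (cmod (v a x))\<^sup>2) has_sum c a * (ell2_norm (v a))\<^sup>2) UNIV"
    unfolding ell2_norm_sq using insert.prems[of a]
    by (intro has_sum_cmult_right has_sum_infsum ell2_summable) auto
  then show ?case using insert by (auto intro: has_sum_add)
qed simp

lemma dyads_trace_eq:
  assumes J: "finite J" and L: "finite L"
    and v: "\<And>a. a \<in> J \<Longrightarrow> v a \<in> ell2 S" and w: "\<And>a. a \<in> L \<Longrightarrow> w a \<in> ell2 S"
    and eq: "dyads S J c v = dyads S L d w"
  shows "(\<Sum>a\<in>J. c a * (ell2_norm (v a))\<^sup>2) = (\<Sum>a\<in>L. d a * (ell2_norm (w a))\<^sup>2)"
proof -
  have "complex_of_real (\<Sum>a\<in>J. c a * (cmod (v a x))\<^sup>2)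
      = complex_of_real (\<Sum>a\<in>L. d a * (cmod (w a x))\<^sup>2)" for x
    by (simp only: dyads_kernel_diag dyads_eq_imp_kernel_eq[OF v w eq])
  then have "(\<Sum>a\<in>J. c a * (cmod (v a x))\<^sup>2) = (\<Sum>a\<in>L. d a * (cmod (w a x))\<^sup>2)" for x
    by (simp only: of_real_eq_iff)
  then show ?thesis
    using has_sum_unique[OF dyads_trace_has_sum[where c = c and v = v, OF J v]]
      dyads_trace_has_sum[where c = d and v = w, OF L w] by simp
qed

text \<open>
  Both sides are the trace of the square of the operator. Expressing the sesquilinear form
  \<open>\<langle>g, \<rho> f\<rangle>\<close> through either family, one replaces the \<open>v\<^sub>a\<close> by the \<open>w\<^sub>a\<close> first in one factor and then
  in the other.
\<close>

lemma dyads_purity_eq: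
  assumes v: "\<And>a. a \<in> J \<Longrightarrow> v a \<in> ell2 S" and w: "\<And>a. a \<in> L \<Longrightarrow> w a \<in> ell2 S"
    and eq: "dyads S J c v = dyads S L d w"
  shows "(\<Sum>a\<in>J. \<Sum>b\<in>J. c a * c b * (cmod (ell2_inner (v a) (v b)))\<^sup>2)
    = (\<Sum>a\<in>L. \<Sum>b\<in>L. d a * d b * (cmod (ell2_inner (w a) (w b)))\<^sup>2)"
proof -
  have form: "(\<Sum>a\<in>J. complex_of_real (c a) * ell2_inner (v a) f * ell2_inner g (v a))
      = (\<Sum>a\<in>L. complex_of_real (d a) * ell2_inner (w a) f * ell2_inner g (w a))"
    if "f \<in> ell2 S" "g \<in> ell2 S" for f g
    using inner_dyads[where c = c and J = J and v = v, OF v that] inner_dyads[where c = d and J = L and v = w, OF w that] eq by simp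
  let ?c = "\<lambda>a. complex_of_real (c a)" and ?d = "\<lambda>a. complex_of_real (d a)"
  have sq: "complex_of_real ((cmod (ell2_inner f g))\<^sup>2) = ell2_inner f g * ell2_inner g f"
    for f g :: "'b \<Rightarrow> complex"
    by (simp only: complex_norm_square ell2_inner_cnj)
  have "complex_of_real (\<Sum>a\<in>J. \<Sum>b\<in>J. c a * c b * (cmod (ell2_inner (v a) (v b)))\<^sup>2)
      = (\<Sum>b\<in>J. ?c b * (\<Sum>a\<in>J. ?c a * ell2_inner (v a) (v b) * ell2_inner (v b) (v a)))"
    unfolding of_real_sum of_real_mult sq sum_distrib_left
    by (subst sum.swap) (simp only: mult_ac)
  also have "\<dots> = (\<Sum>b\<in>J. ?c b * (\<Sum>a\<in>L. ?d a * ell2_inner (w a) (v b) * ell2_inner (v b) (w a)))"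
    by (intro sum.cong refl arg_cong2[where f = "(*)"] form v)
  also have "\<dots> = (\<Sum>a\<in>L. ?d a * (\<Sum>b\<in>J. ?c b * ell2_inner (v b) (w a) * ell2_inner (w a) (v b)))"
    unfolding sum_distrib_left by (subst sum.swap) (simp only: mult_ac)
  also have "\<dots> = (\<Sum>a\<in>L. ?d a * (\<Sum>b\<in>L. ?d b * ell2_inner (w b) (w a) * ell2_inner (w a) (w b)))"
    by (intro sum.cong refl arg_cong2[where f = "(*)"] form w)
  also have "\<dots> = complex_of_real (\<Sum>a\<in>L. \<Sum>b\<in>L. d a * d b * (cmod (ell2_inner (w a) (w b)))\<^sup>2)"
    unfolding of_real_sum of_real_mult sq sum_distrib_left by (simp only: mult_ac)
  finally show ?thesis by (simp only: of_real_eq_iff)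
qed

text \<open>
  An eigenvector \<open>f\<close> for \<open>m \<noteq> 0\<close> lies in the range of the operator, hence in the span of the \<open>e\<^sub>a\<close>;
  comparing coefficients, only those \<open>a\<close> with \<open>\<mu>\<^sub>a = m\<close> contribute.
\<close>

lemma eigenspace_dyads:
  assumes J: "finite J" and on: "orthonormal S J e" and m: "m \<noteq> 0"
  shows "eigenspace S (dyads S J \<mu> e) (complex_of_real m) = cfun.span (e ` {a \<in> J. \<mu> a = m})"
proof (intro equalityI subsetI)
  fix f assume "f \<in> eigenspace S (dyads S J \<mu> e) (complex_of_real m)"
  then have f: "f \<in> ell2 S" and ev: "dyads S J \<mu> e f = (\<lambda>x. complex_of_real m * f x)"
    by (auto simp: eigenspace_def)
  have "ell2_inner (e b) f = 0" if b: "b \<in> J" "\<mu> b \<noteq> m" for b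
  proof -
    have "complex_of_real m * ell2_inner (e b) f = ell2_inner (e b) (dyads S J \<mu> e f)"
      by (simp add: ev ell2_inner_scale_right)
    also have "\<dots> = complex_of_real (\<mu> b) * ell2_inner (e b) f"
      unfolding dyads_apply[OF f] by (rule orthonormal_inner_sum[OF on J b(1)])
    finally show ?thesis using b(2) by simp
  qed
  moreover have "f = (\<lambda>x. complex_of_real (1 / m) * dyads S J \<mu> e f x)"
    using m by (simp add: ev)
  then have "f x = (\<Sum>a\<in>J. complex_of_real (1 / m) * (complex_of_real (\<mu> a) * ell2_inner (e a) f * e a x))"
    for x
    unfolding dyads_apply[OF f] by (simp add: fun_eq_iff sum_distrib_left)
  moreover have "(\<Sum>a\<in>J. complex_of_real (1 / m) * (complex_of_real (\<mu> a) * ell2_inner (e a) f * e a x))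
      = (\<Sum>a\<in>{a \<in> J. \<mu> a = m}. ell2_inner (e a) f * e a x)" for x
    by (rule sum.mono_neutral_cong_right) (use J m calculation(1) in auto)
  ultimately have "f = (\<Sum>a\<in>{a \<in> J. \<mu> a = m}. (\<lambda>x. ell2_inner (e a) f * e a x))"
    by (simp add: fun_eq_iff sum_fun_apply)
  also have "\<dots> \<in> cfun.span (e ` {a \<in> J. \<mu> a = m})"
    by (intro cfun.span_sum cfun.span_scale cfun.span_base) auto
  finally show "f \<in> cfun.span (e ` {a \<in> J. \<mu> a = m})" .
next
  have "cfun.subspace (eigenspace S (dyads S J \<mu> e) (complex_of_real m))"
  proof (rule cfun.subspaceI)
    show "0 \<in> eigenspace S (dyads S J \<mu> e) (complex_of_real m)"
      by (simp add: eigenspace_def zero_fun_def dyads_apply ell2_zero ell2_inner_zero_right)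
  next
    fix f g
    assume fg: "f \<in> eigenspace S (dyads S J \<mu> e) (complex_of_real m)"
      "g \<in> eigenspace S (dyads S J \<mu> e) (complex_of_real m)"
    then have f: "f \<in> ell2 S" and g: "g \<in> ell2 S" by (auto simp: eigenspace_def)
    have "dyads S J \<mu> e (\<lambda>x. f x + g x) = (\<lambda>x. dyads S J \<mu> e f x + dyads S J \<mu> e g x)"
      using orthonormal_ell2[OF on]
      by (auto simp: dyads_apply f g ell2_add ell2_inner_add_right[OF _ f g] sum.distrib[symmetric]
          algebra_simps intro!: sum.cong)
    then show "f + g \<in> eigenspace S (dyads S J \<mu> e) (complex_of_real m)"
      using fg by (simp add: eigenspace_def plus_fun_def ell2_add algebra_simps)
  next
    fix z f assume fe: "f \<in> eigenspace S (dyads S J \<mu> e) (complex_of_real m)"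
    then have f: "f \<in> ell2 S" by (auto simp: eigenspace_def)
    have "dyads S J \<mu> e (\<lambda>x. z * f x) = (\<lambda>x. z * dyads S J \<mu> e f x)"
      by (simp add: dyads_apply f ell2_scale ell2_inner_scale_right sum_distrib_left mult_ac)
    moreover have "dyads S J \<mu> e f = (\<lambda>x. complex_of_real m * f x)"
      using fe by (simp add: eigenspace_def)
    ultimately have "dyads S J \<mu> e (\<lambda>x. z * f x) = (\<lambda>x. complex_of_real m * (z * f x))"
      by (simp only: mult.left_commute[of z])
    then show "(\<lambda>x. z * f x) \<in> eigenspace S (dyads S J \<mu> e) (complex_of_real m)"
      by (simp only: eigenspace_def mem_Collect_eq ell2_scale[OF f] simp_thms)
  qed
  moreover have "e ` {a \<in> J. \<mu> a = m} \<subseteq> eigenspace S (dyads S J \<mu> e) (complex_of_real m)"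
  proof
    fix f assume "f \<in> e ` {a \<in> J. \<mu> a = m}"
    then obtain b where b: "b \<in> J" "\<mu> b = m" "f = e b" by auto
    have "(\<Sum>a\<in>J. complex_of_real (\<mu> a) * ell2_inner (e a) (e b) * e a x)
        = (\<Sum>a\<in>J. if a = b then complex_of_real m * e b x else 0)" for x
      using on b by (intro sum.cong) (auto simp: orthonormal_def)
    then show "f \<in> eigenspace S (dyads S J \<mu> e) (complex_of_real m)"
      using orthonormal_ell2[OF on b(1)] b J by (simp add: eigenspace_def dyads_apply)
  qed
  ultimately have "cfun.span (e ` {a \<in> J. \<mu> a = m})
      \<subseteq> eigenspace S (dyads S J \<mu> e) (complex_of_real m)"
    by (rule cfun.span_minimal[rotated])
  then show "f \<in> eigenspace S (dyads S J \<mu> e) (complex_of_real m)"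
    if "f \<in> cfun.span (e ` {a \<in> J. \<mu> a = m})" for f
    using that by blast
qed

text \<open>
  The sum over distinct eigenvalues with multiplicities is the sum over the orthonormal family. The
  only other possible eigenvalue is 0, which contributes nothing.
\<close>

theorem vN_entropy_dyads:
  assumes J: "finite J" and on: "orthonormal S J e" and pos: "\<And>a. a \<in> J \<Longrightarrow> \<mu> a > 0"
  shows "vN_entropy S (dyads S J \<mu> e) = ereal (\<Sum>a\<in>J. - (\<mu> a * ln (\<mu> a)))"
proof -
  let ?es = "\<lambda>m. eigenspace S (dyads S J \<mu> e) (complex_of_real m)"
  let ?t = "\<lambda>m. ereal (real (cfun.dim (?es m)) * (- (m * ln m)))"
  have dim: "cfun.dim (?es m) = card {a \<in> J. \<mu> a = m}" if "m \<noteq> 0" for m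
  proof -
    have on': "orthonormal S {a \<in> J. \<mu> a = m} e" using on by (auto simp: orthonormal_def)
    show ?thesis
      unfolding eigenspace_dyads[OF J on that]
      using cfun.dim_span_eq_card_independent[OF orthonormal_independent[OF on']] J
      by (simp add: card_image[OF orthonormal_inj_on[OF on']])
  qed
  have "vN_entropy S (dyads S J \<mu> e) = (\<Sum>\<^sub>\<infinity>m\<in>\<mu> ` J. ?t m)"
    unfolding vN_entropy_def
  proof (rule infsum_cong_neutral)
    fix m assume "m \<in> {m. ?es m \<noteq> {\<lambda>_. 0}} - \<mu> ` J"
    then have m: "?es m \<noteq> {\<lambda>_. 0}" "{a \<in> J. \<mu> a = m} = {}" by auto
    have "m = 0"
    proof (rule ccontr)
      assume "m \<noteq> 0"
      then show False
        using eigenspace_dyads[OF J on, of m \<mu>] m by (simp add: zero_fun_def)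
    qed
    then show "?t m = 0" by (simp add: zero_ereal_def)
  next
    fix m assume "m \<in> \<mu> ` J - {m. ?es m \<noteq> {\<lambda>_. 0}}"
    then obtain a where a: "a \<in> J" "\<mu> a = m" and z: "?es m = {\<lambda>_. 0}" by auto
    have "e a \<in> ?es m"
      using a pos[OF a(1)] by (subst eigenspace_dyads[OF J on]) (auto intro!: cfun.span_base)
    then have "e a = (\<lambda>_. 0)" using z by simp
    then have "ell2_inner (e a) (e a) = 0" by (simp add: ell2_inner_zero_right)
    then show "?t m = 0" using on a by (simp add: orthonormal_def)
  qed simp
  also have "\<dots> = (\<Sum>m\<in>\<mu> ` J. ?t m)" using J by simp
  also have "\<dots> = (\<Sum>m\<in>\<mu> ` J. ereal (\<Sum>a\<in>{a \<in> J. \<mu> a = m}. - (\<mu> a * ln (\<mu> a))))"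
  proof (rule sum.cong[OF refl])
    fix m assume "m \<in> \<mu> ` J"
    then have "m \<noteq> 0" using pos by force
    then show "?t m = ereal (\<Sum>a\<in>{a \<in> J. \<mu> a = m}. - (\<mu> a * ln (\<mu> a)))"
      by (simp add: dim)
  qed
  also have "\<dots> = ereal (\<Sum>a\<in>J. - (\<mu> a * ln (\<mu> a)))"
    by (subst sum_ereal, subst sum.image_gen[OF J, of _ \<mu>]) simp
  finally show ?thesis .
qed

text \<open>
  Jensen's inequality, in the form of the tangent bound \<open>ln (\<mu>/p) \<le> \<mu>/p - 1\<close>: the entropy is at least
  the collision entropy.
\<close>

lemma entropy_ge_neg_ln_purity:
  fixes \<mu> :: "'i \<Rightarrow> real"
  assumes pos: "\<And>a. a \<in> J \<Longrightarrow> \<mu> a > 0" and tr: "(\<Sum>a\<in>J. \<mu> a) = 1"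
    and pur: "(\<Sum>a\<in>J. (\<mu> a)\<^sup>2) \<le> p" and p: "p > 0"
  shows "(\<Sum>a\<in>J. - (\<mu> a * ln (\<mu> a))) \<ge> - ln p"
proof -
  have "- (\<mu> a * ln (\<mu> a)) \<ge> \<mu> a * (1 - ln p) - (\<mu> a)\<^sup>2 / p" if a: "a \<in> J" for a
  proof -
    have "ln (\<mu> a / p) \<le> \<mu> a / p - 1" using pos[OF a] p by (intro ln_le_minus_one) simp
    then have "ln (\<mu> a) \<le> ln p + \<mu> a / p - 1" using pos[OF a] p by (simp add: ln_div)
    then have "\<mu> a * ln (\<mu> a) \<le> \<mu> a * (ln p + \<mu> a / p - 1)"
      using pos[OF a] by (intro mult_left_mono) auto
    then show ?thesis by (simp add: algebra_simps power2_eq_square)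
  qed
  then have "(\<Sum>a\<in>J. \<mu> a * (1 - ln p) - (\<mu> a)\<^sup>2 / p) \<le> (\<Sum>a\<in>J. - (\<mu> a * ln (\<mu> a)))"
    by (rule sum_mono)
  also have "(\<Sum>a\<in>J. \<mu> a * (1 - ln p) - (\<mu> a)\<^sup>2 / p) = 1 - ln p - (\<Sum>a\<in>J. (\<mu> a)\<^sup>2) / p"
    using tr by (simp add: sum_subtractf sum_distrib_right[symmetric] sum_divide_distrib[symmetric])
  finally show ?thesis
    using pur p by (smt (verit) divide_le_eq_1)
qed

lemma entropy_nonneg:
  fixes \<mu> :: "'i \<Rightarrow> real"
  assumes "finite J" "\<And>a. a \<in> J \<Longrightarrow> \<mu> a > 0" "(\<Sum>a\<in>J. \<mu> a) = 1"
  shows "(\<Sum>a\<in>J. - (\<mu> a * ln (\<mu> a))) \<ge> 0"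
proof (rule sum_nonneg)
  fix a assume a: "a \<in> J"
  have "\<mu> a \<le> 1"
    using member_le_sum[OF a, of \<mu>] assms by (simp add: less_imp_le)
  then show "0 \<le> - (\<mu> a * ln (\<mu> a))"
    using assms(2)[OF a] by (simp add: mult_nonneg_nonpos)
qed

text \<open>
  Trace and purity do not depend on how the mixture is decomposed, so those of the spectrum can be
  computed from the \<open>v\<^sub>i\<close>.
\<close>

lemma uniform_mixture_spectrum:
  fixes v :: "'i \<Rightarrow> 'a \<Rightarrow> complex"
  assumes J: "finite J" "J \<noteq> {}" and v: "\<And>i. i \<in> J \<Longrightarrow> v i \<in> ell2 S"
    and unit: "\<And>i. i \<in> J \<Longrightarrow> ell2_norm (v i) = 1"
  obtains E \<mu> where "finite E" "orthonormal S E (\<lambda>e. e)" "\<And>e. e \<in> E \<Longrightarrow> \<mu> e > 0"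
    "(\<Sum>e\<in>E. \<mu> e) = 1"
    "(\<Sum>e\<in>E. (\<mu> e)\<^sup>2) = (\<Sum>i\<in>J. \<Sum>j\<in>J. (cmod (ell2_inner (v i) (v j)))\<^sup>2) / (real (card J))\<^sup>2"
    "dyads S J (\<lambda>_. 1 / real (card J)) v = dyads S E \<mu> (\<lambda>e. e)"
proof -
  let ?r = "1 / real (card J)"
  have card: "real (card J) > 0" using J by (simp add: card_gt_0_iff)
  then have "?r > 0" by simp
  from dyads_spectral_decomposition[of J v S, OF J(1) v this]
  obtain E \<mu> where E: "finite E" "orthonormal S E (\<lambda>e. e)" "\<forall>e\<in>E. \<mu> e > 0"
    and eq: "dyads S J (\<lambda>_. ?r) v = dyads S E \<mu> (\<lambda>e. e)"
    by metis
  have e: "e \<in> ell2 S" "ell2_norm e = 1" if "e \<in> E" for e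
  proof -
    show "e \<in> ell2 S" using orthonormal_ell2[OF E(2) that] .
    then have "complex_of_real ((ell2_norm e)\<^sup>2) = 1"
      using E(2) that ell2_inner_self[of e S] by (simp add: orthonormal_def)
    then have "(ell2_norm e)\<^sup>2 = 1" by (simp only: of_real_eq_1_iff)
    then show "ell2_norm e = 1" using ell2_norm_nonneg[of e] by (simp add: power2_eq_1_iff)
  qed
  have "(\<Sum>e\<in>E. \<mu> e) = (\<Sum>i\<in>J. ?r)"
    using dyads_trace_eq[OF J(1) E(1) v e(1) eq] e(2) unit by simp
  then have tr: "(\<Sum>e\<in>E. \<mu> e) = 1" using card by simp
  have "(\<Sum>e\<in>E. (\<mu> e)\<^sup>2) = (\<Sum>a\<in>E. \<Sum>b\<in>E. \<mu> a * \<mu> b * (cmod (ell2_inner a b))\<^sup>2)"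
  proof (rule sum.cong[OF refl])
    fix a assume a: "a \<in> E"
    have "(\<Sum>b\<in>E. \<mu> a * \<mu> b * (cmod (ell2_inner a b))\<^sup>2) = (\<Sum>b\<in>E. if b = a then (\<mu> a)\<^sup>2 else 0)"
      using E(2) a by (intro sum.cong) (auto simp: orthonormal_def power2_eq_square)
    then show "(\<mu> a)\<^sup>2 = (\<Sum>b\<in>E. \<mu> a * \<mu> b * (cmod (ell2_inner a b))\<^sup>2)"
      using a E(1) by simp
  qed
  also have "\<dots> = (\<Sum>i\<in>J. \<Sum>j\<in>J. ?r * ?r * (cmod (ell2_inner (v i) (v j)))\<^sup>2)"
    by (rule dyads_purity_eq[OF v e(1) eq, symmetric])
  also have "\<dots> = (\<Sum>i\<in>J. \<Sum>j\<in>J. (cmod (ell2_inner (v i) (v j)))\<^sup>2) / (real (card J))\<^sup>2"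
    by (simp add: sum_divide_distrib power2_eq_square)
  finally show thesis
    using that[of E \<mu>] E tr eq by blast
qed

section \<open>Product inputs and subadditivity\<close>

lemma abs_summable_on_Times:
  fixes f :: "'a \<Rightarrow> 'c::{banach, real_normed_div_algebra}" and g :: "'b \<Rightarrow> 'c"
  assumes "(\<lambda>x. norm (f x)) summable_on A" "(\<lambda>y. norm (g y)) summable_on B"
  shows "(\<lambda>xy. norm (case xy of (x, y) \<Rightarrow> f x * g y)) summable_on A \<times> B"
proof -
  have "(\<lambda>x. norm (f x) * (\<Sum>\<^sub>\<infinity>y\<in>B. norm (g y))) summable_on A"
    by (rule summable_on_cmult_left[OF assms(1)])
  then show ?thesis
    using assms(2) unfolding Infinite_Sum.abs_summable_on_Sigma_iff[where f = "\<lambda>(x, y). f x * g y"]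
    by (auto simp: norm_mult infsum_cmult_right' infsum_nonneg intro: summable_on_cmult_right)
qed

lemma infsum_Times:
  fixes f :: "'a \<Rightarrow> 'c::{banach, real_normed_div_algebra}" and g :: "'b \<Rightarrow> 'c"
  assumes "(\<lambda>x. norm (f x)) summable_on A" "(\<lambda>y. norm (g y)) summable_on B"
  shows "(\<Sum>\<^sub>\<infinity>(x, y)\<in>A \<times> B. f x * g y) = (\<Sum>\<^sub>\<infinity>x\<in>A. f x) * (\<Sum>\<^sub>\<infinity>y\<in>B. g y)"
proof -
  have "(\<Sum>\<^sub>\<infinity>(x, y)\<in>A \<times> B. f x * g y) = (\<Sum>\<^sub>\<infinity>x\<in>A. \<Sum>\<^sub>\<infinity>y\<in>B. f x * g y)"
    by (rule infsum_Sigma'_banach[symmetric])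
       (rule abs_summable_summable[OF abs_summable_on_Times[where f = f and g = g, OF assms]])
  then show ?thesis by (simp add: infsum_cmult_right' infsum_cmult_left')
qed

text \<open>
  A bijection \<open>x \<mapsto> (p x, q x)\<close> from \<open>R\<close> to \<open>S \<times> T\<close> identifies \<open>\<ell>\<^sup>2(R)\<close> with \<open>\<ell>\<^sup>2(S) \<otimes> \<ell>\<^sup>2(T)\<close>. The
  case in view splits a \<open>(k + m)\<close>-tuple into a \<open>k\<close>-tuple and an \<open>m\<close>-tuple.
\<close>

locale product_split =
  fixes R :: "'r set" and S :: "'s set" and T :: "'t set" and p :: "'r \<Rightarrow> 's" and q :: "'r \<Rightarrow> 't"
  assumes bij: "bij_betw (\<lambda>x. (p x, q x)) R (S \<times> T)"
begin

definition tens :: "('s \<Rightarrow> complex) \<Rightarrow> ('t \<Rightarrow> complex) \<Rightarrow> 'r \<Rightarrow> complex" where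
  "tens f g = (\<lambda>x. if x \<in> R then f (p x) * g (q x) else 0)"

lemma split_mem: "x \<in> R \<Longrightarrow> p x \<in> S" "x \<in> R \<Longrightarrow> q x \<in> T"
  using bij_betwE[OF bij] by auto

lemma tens_ell2:
  assumes "f \<in> ell2 S" "g \<in> ell2 T"
  shows "tens f g \<in> ell2 R"
proof -
  have "(\<lambda>(s, t). (cmod (f s))\<^sup>2 * (cmod (g t))\<^sup>2) summable_on S \<times> T"
    by (rule abs_summable_summable, rule abs_summable_on_Times)
       (use assms in \<open>auto simp: ell2_def\<close>)
  then have "(\<lambda>x. (cmod (f (p x)))\<^sup>2 * (cmod (g (q x)))\<^sup>2) summable_on R"
    using summable_on_reindex_bij_betw[OF bij, of "\<lambda>(s, t). (cmod (f s))\<^sup>2 * (cmod (g t))\<^sup>2"] by simp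
  then show ?thesis
    by (simp add: ell2_def tens_def norm_mult power_mult_distrib cong: summable_on_cong)
qed

lemma tens_inner:
  assumes f: "f \<in> ell2 S" "f' \<in> ell2 S" and g: "g \<in> ell2 T" "g' \<in> ell2 T"
  shows "ell2_inner (tens f g) (tens f' g') = ell2_inner f f' * ell2_inner g g'"
proof -
  let ?F = "\<lambda>s. cnj (f s) * f' s" and ?G = "\<lambda>t. cnj (g t) * g' t"
  have F: "(\<lambda>s. cmod (?F s)) summable_on S"
    by (rule summable_on_subset_banach[OF ell2_inner_abs_summable[OF f]]) simp
  have G: "(\<lambda>t. cmod (?G t)) summable_on T"
    by (rule summable_on_subset_banach[OF ell2_inner_abs_summable[OF g]]) simp
  have "ell2_inner (tens f g) (tens f' g') = (\<Sum>\<^sub>\<infinity>x\<in>R. ?F (p x) * ?G (q x))"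
    unfolding ell2_inner_def by (rule infsum_cong_neutral) (auto simp: tens_def)
  also have "\<dots> = (\<Sum>\<^sub>\<infinity>(s, t)\<in>S \<times> T. ?F s * ?G t)"
    using infsum_reindex_bij_betw[OF bij, of "\<lambda>(s, t). ?F s * ?G t"] by simp
  also have "\<dots> = (\<Sum>\<^sub>\<infinity>s\<in>S. ?F s) * (\<Sum>\<^sub>\<infinity>t\<in>T. ?G t)"
    by (rule infsum_Times[where f = ?F and g = ?G, OF F G])
  also have "(\<Sum>\<^sub>\<infinity>s\<in>S. ?F s) = ell2_inner f f'"
    unfolding ell2_inner_def by (rule infsum_cong_neutral) (use ell2_outside[OF f(1)] in auto)
  also have "(\<Sum>\<^sub>\<infinity>t\<in>T. ?G t) = ell2_inner g g'"
    unfolding ell2_inner_def by (rule infsum_cong_neutral) (use ell2_outside[OF g(1)] in auto)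
  finally show ?thesis .
qed

lemma tens_norm:
  assumes f: "f \<in> ell2 S" and g: "g \<in> ell2 T"
  shows "ell2_norm (tens f g) = ell2_norm f * ell2_norm g"
proof -
  have "complex_of_real ((ell2_norm (tens f g))\<^sup>2)
      = complex_of_real ((ell2_norm f)\<^sup>2) * complex_of_real ((ell2_norm g)\<^sup>2)"
    unfolding ell2_inner_self[OF tens_ell2[OF f g], symmetric] ell2_inner_self[OF f, symmetric]
      ell2_inner_self[OF g, symmetric] by (rule tens_inner[OF f f g g])
  then have "(ell2_norm (tens f g))\<^sup>2 = (ell2_norm f * ell2_norm g)\<^sup>2"
    by (simp only: of_real_mult[symmetric] of_real_eq_iff power_mult_distrib)
  then show ?thesis by (rule power2_eq_imp_eq) simp_all
qed

lemma tens_orthonormal: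
  assumes e: "orthonormal S J e" and f: "orthonormal T L f"
  shows "orthonormal R (J \<times> L) (\<lambda>(a, b). tens (e a) (f b))"
  unfolding orthonormal_def
proof (intro conjI ballI)
  fix ab assume "ab \<in> J \<times> L"
  then show "(case ab of (a, b) \<Rightarrow> tens (e a) (f b)) \<in> ell2 R"
    by (auto intro: tens_ell2 orthonormal_ell2[OF e] orthonormal_ell2[OF f])
next
  fix ab cd assume "ab \<in> J \<times> L" "cd \<in> J \<times> L"
  then obtain a b c d where eqs: "ab = (a, b)" "cd = (c, d)" and mem: "a \<in> J" "b \<in> L" "c \<in> J" "d \<in> L"
    by auto
  have "ell2_inner (tens (e a) (f b)) (tens (e c) (f d)) = ell2_inner (e a) (e c) * ell2_inner (f b) (f d)"
    by (rule tens_inner) (use mem orthonormal_ell2[OF e] orthonormal_ell2[OF f] in auto)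
  then show "ell2_inner (case ab of (a, b) \<Rightarrow> tens (e a) (f b)) (case cd of (a, b) \<Rightarrow> tens (e a) (f b))
      = (if ab = cd then 1 else 0)"
    using e f mem by (simp add: eqs orthonormal_def)
qed

lemma tens_kernel:
  assumes "x \<in> R" "y \<in> R"
  shows "dyads_kernel (J \<times> L) (\<lambda>(a, b). c a * d b) (\<lambda>(a, b). tens (v a) (w b)) x y
    = dyads_kernel J c v (p x) (p y) * dyads_kernel L d w (q x) (q y)"
  using assms
  by (simp add: dyads_kernel_def sum_product sum.cartesian_product tens_def case_prod_unfold mult_ac)

lemma tens_dyads_cong:
  assumes v: "\<And>a. a \<in> J \<Longrightarrow> v a \<in> ell2 S" and v': "\<And>a. a \<in> J' \<Longrightarrow> v' a \<in> ell2 S"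
    and w: "\<And>a. a \<in> L \<Longrightarrow> w a \<in> ell2 T" and w': "\<And>a. a \<in> L' \<Longrightarrow> w' a \<in> ell2 T"
    and eq1: "dyads S J c v = dyads S J' c' v'" and eq2: "dyads T L d w = dyads T L' d' w'"
  shows "dyads R (J \<times> L) (\<lambda>(a, b). c a * d b) (\<lambda>(a, b). tens (v a) (w b))
    = dyads R (J' \<times> L') (\<lambda>(a, b). c' a * d' b) (\<lambda>(a, b). tens (v' a) (w' b))"
proof (rule kernel_eq_imp_dyads_eq)
  fix x y
  show "dyads_kernel (J \<times> L) (\<lambda>(a, b). c a * d b) (\<lambda>(a, b). tens (v a) (w b)) x y
    = dyads_kernel (J' \<times> L') (\<lambda>(a, b). c' a * d' b) (\<lambda>(a, b). tens (v' a) (w' b)) x y"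
  proof (cases "x \<in> R \<and> y \<in> R")
    case True
    then show ?thesis
      using dyads_eq_imp_kernel_eq[OF v v' eq1] dyads_eq_imp_kernel_eq[OF w w' eq2]
      by (simp add: tens_kernel)
  next
    case False
    then show ?thesis
      by (auto simp: dyads_kernel_def tens_def case_prod_unfold)
  qed
qed (auto intro: tens_ell2 v v' w w')

lemma tens_perm_vec:
  assumes "\<And>x. x \<in> R \<Longrightarrow> \<tau> x \<in> R" "\<And>x. x \<in> R \<Longrightarrow> p (\<tau> x) = \<sigma> (p x)"
    "\<And>x. x \<in> R \<Longrightarrow> q (\<tau> x) = \<sigma>' (q x)"
  shows "perm_vec R \<tau> (tens f g) = tens (perm_vec S \<sigma> f) (perm_vec T \<sigma>' g)"
  using assms split_mem by (auto simp: perm_vec_def tens_def fun_eq_iff)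

end

lemma entropy_product:
  fixes \<mu> :: "'i \<Rightarrow> real" and \<nu> :: "'j \<Rightarrow> real"
  assumes "\<And>a. a \<in> J \<Longrightarrow> \<mu> a > 0" "\<And>b. b \<in> L \<Longrightarrow> \<nu> b > 0"
    and tr: "(\<Sum>a\<in>J. \<mu> a) = 1" "(\<Sum>b\<in>L. \<nu> b) = 1"
  shows "(\<Sum>(a, b)\<in>J \<times> L. - (\<mu> a * \<nu> b * ln (\<mu> a * \<nu> b)))
    = (\<Sum>a\<in>J. - (\<mu> a * ln (\<mu> a))) + (\<Sum>b\<in>L. - (\<nu> b * ln (\<nu> b)))"
proof -
  have "(\<Sum>(a, b)\<in>J \<times> L. - (\<mu> a * \<nu> b * ln (\<mu> a * \<nu> b)))
      = (\<Sum>a\<in>J. \<Sum>b\<in>L. - (\<mu> a * ln (\<mu> a)) * \<nu> b + \<mu> a * - (\<nu> b * ln (\<nu> b)))"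
    unfolding sum.cartesian_product[symmetric]
  proof (intro sum.cong refl)
    fix a b assume "a \<in> J" "b \<in> L"
    then show "- (\<mu> a * \<nu> b * ln (\<mu> a * \<nu> b)) = - (\<mu> a * ln (\<mu> a)) * \<nu> b + \<mu> a * - (\<nu> b * ln (\<nu> b))"
      using assms(1)[of a] assms(2)[of b] by (simp add: ln_mult algebra_simps)
  qed
  also have "\<dots> = (\<Sum>a\<in>J. - (\<mu> a * ln (\<mu> a))) * (\<Sum>b\<in>L. \<nu> b) + (\<Sum>a\<in>J. \<mu> a) * (\<Sum>b\<in>L. - (\<nu> b * ln (\<nu> b)))"
    by (simp only: sum.distrib sum_product)
  finally show ?thesis using tr by simp
qed

abbreviation tuple_fst :: "nat \<Rightarrow> (nat \<Rightarrow> 'a) \<Rightarrow> nat \<Rightarrow> 'a" where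
  "tuple_fst k x \<equiv> (\<lambda>j\<in>{..<k}. x j)"

abbreviation tuple_snd :: "nat \<Rightarrow> nat \<Rightarrow> (nat \<Rightarrow> 'a) \<Rightarrow> nat \<Rightarrow> 'a" where
  "tuple_snd k m x \<equiv> (\<lambda>j\<in>{..<m}. x (k + j))"

lemma bij_betw_tuple_split:
  "bij_betw (\<lambda>x. (tuple_fst k x, tuple_snd k m x)) (tuples S (k + m)) (tuples S k \<times> tuples S m)"
proof (rule bij_betw_byWitness[where
    f' = "\<lambda>(y, z). \<lambda>j\<in>{..<k + m}. if j < k then y j else z (j - k)"])
  show "\<forall>x\<in>tuples S (k + m). (case (tuple_fst k x, tuple_snd k m x) of
      (y, z) \<Rightarrow> \<lambda>j\<in>{..<k + m}. if j < k then y j else z (j - k)) = x"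
    by (auto simp: tuples_def fun_eq_iff PiE_iff extensional_def)
  show "\<forall>yz\<in>tuples S k \<times> tuples S m.
      (tuple_fst k (case yz of (y, z) \<Rightarrow> \<lambda>j\<in>{..<k + m}. if j < k then y j else z (j - k)),
       tuple_snd k m (case yz of (y, z) \<Rightarrow> \<lambda>j\<in>{..<k + m}. if j < k then y j else z (j - k))) = yz"
    by (auto simp: tuples_def fun_eq_iff PiE_iff extensional_def)
  show "(\<lambda>x. (tuple_fst k x, tuple_snd k m x)) ` tuples S (k + m) \<subseteq> tuples S k \<times> tuples S m"
  proof (rule image_subsetI)
    fix x assume "x \<in> tuples S (k + m)"
    then have "x j \<in> S" if "j < k + m" for j using that by (auto simp: tuples_def)
    then show "(tuple_fst k x, tuple_snd k m x) \<in> tuples S k \<times> tuples S m"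
      by (simp add: tuples_def)
  qed
  show "(\<lambda>(y, z). \<lambda>j\<in>{..<k + m}. if j < k then y j else z (j - k)) ` (tuples S k \<times> tuples S m)
      \<subseteq> tuples S (k + m)"
  proof clarify
    fix y z :: "nat \<Rightarrow> 'a" assume "y \<in> tuples S k" "z \<in> tuples S m"
    then have "\<forall>j<k. y j \<in> S" "\<forall>j<m. z j \<in> S" by (auto simp: tuples_def)
    then show "(\<lambda>j\<in>{..<k + m}. if j < k then y j else z (j - k)) \<in> tuples S (k + m)"
      by (simp add: tuples_def less_diff_conv2)
  qed
qed

lemma product_split_tuples:
  "product_split (tuples S (k + m)) (tuples S k) (tuples S m) (tuple_fst k) (tuple_snd k m)"
  by (rule product_split.intro[OF bij_betw_tuple_split])

text \<open>
  Channels that average over finitely many permutations of the basis. The channel of the free group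
  is of this kind, as translations permute the group elements. Subadditivity of the minimum output
  entropy is proved for all such channels.
\<close>

locale permutation_channel =
  fixes S :: "'a set" and I :: "'i set" and V :: "'i \<Rightarrow> 'a operator" and \<sigma> :: "'i \<Rightarrow> 'a \<Rightarrow> 'a"
  assumes I: "finite I" "I \<noteq> {}" and S: "S \<noteq> {}"
    and \<sigma>: "\<And>i. i \<in> I \<Longrightarrow> bij_betw (\<sigma> i) S S" and V: "\<And>i. i \<in> I \<Longrightarrow> V i = perm_op S (\<sigma> i)"
begin

definition translate :: "nat \<Rightarrow> (nat \<Rightarrow> 'i) \<Rightarrow> (nat \<Rightarrow> 'a) \<Rightarrow> nat \<Rightarrow> 'a" where
  "translate k i = tuple_map k (\<lambda>j. \<sigma> (i j))"

text \<open>The vector \<open>U\<^sub>i \<xi>\<close>, where \<open>U\<^sub>i\<close> is the tensor product of the \<open>V (i j)\<close>.\<close>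

definition branch :: "nat \<Rightarrow> ((nat \<Rightarrow> 'a) \<Rightarrow> complex) \<Rightarrow> (nat \<Rightarrow> 'i) \<Rightarrow> (nat \<Rightarrow> 'a) \<Rightarrow> complex" where
  "branch k \<xi> i = perm_vec (tuples S k) (translate k i) \<xi>"

definition pure :: "nat \<Rightarrow> ((nat \<Rightarrow> 'a) \<Rightarrow> complex) set" where
  "pure k = {\<xi> \<in> ell2 (tuples S k). ell2_norm \<xi> = 1}"

definition output_entropy :: "nat \<Rightarrow> ((nat \<Rightarrow> 'a) \<Rightarrow> complex) \<Rightarrow> ereal" where
  "output_entropy k \<xi> =
     vN_entropy (tuples S k) (mixed_unitary_power S I V k (ketbra (tuples S k) \<xi>))"

lemma translate_bij: "i \<in> tuples I k \<Longrightarrow> bij_betw (translate k i) (tuples S k) (tuples S k)"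
  unfolding translate_def by (rule bij_betw_tuple_map) (auto simp: tuples_def intro: \<sigma>)

lemma branch_ell2: "i \<in> tuples I k \<Longrightarrow> \<xi> \<in> pure k \<Longrightarrow> branch k \<xi> i \<in> ell2 (tuples S k)"
  unfolding branch_def pure_def using translate_bij by (auto intro: perm_vec_ell2)

lemma branch_norm: "i \<in> tuples I k \<Longrightarrow> \<xi> \<in> pure k \<Longrightarrow> ell2_norm (branch k \<xi> i) = 1"
  unfolding branch_def pure_def using ell2_norm_perm_vec[OF translate_bij] by auto

lemma finite_tuples: "finite (tuples I k)"
  unfolding tuples_def by (intro finite_PiE) (auto simp: I)

lemma tuples_nonempty: "tuples I k \<noteq> {}"
  unfolding tuples_def by (auto simp: PiE_eq_empty_iff I)

lemma card_tuples: "card (tuples I k) = card I ^ k"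
  by (simp add: tuples_def card_PiE)

lemma output_dyads:
  "\<xi> \<in> pure k \<Longrightarrow> mixed_unitary_power S I V k (ketbra (tuples S k) \<xi>)
    = dyads (tuples S k) (tuples I k) (\<lambda>_. 1 / real (card (tuples I k))) (branch k \<xi>)"
  unfolding branch_def translate_def card_tuples pure_def
  by (rule mixed_perm_power_output) (auto intro: \<sigma> V)

lemma output_spectrum:
  assumes "\<xi> \<in> pure k"
  obtains E \<mu> where "finite E" "orthonormal (tuples S k) E (\<lambda>e. e)" "\<And>e. e \<in> E \<Longrightarrow> \<mu> e > 0"
    "(\<Sum>e\<in>E. \<mu> e) = 1"
    "(\<Sum>e\<in>E. (\<mu> e)\<^sup>2) = (\<Sum>i\<in>tuples I k. \<Sum>j\<in>tuples I k.
        (cmod (ell2_inner (branch k \<xi> i) (branch k \<xi> j)))\<^sup>2) / (real (card I ^ k))\<^sup>2"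
    "dyads (tuples S k) (tuples I k) (\<lambda>_. 1 / real (card (tuples I k))) (branch k \<xi>)
      = dyads (tuples S k) E \<mu> (\<lambda>e. e)"
    "output_entropy k \<xi> = ereal (\<Sum>e\<in>E. - (\<mu> e * ln (\<mu> e)))"
proof -
  obtain E \<mu> where E: "finite E" "orthonormal (tuples S k) E (\<lambda>e. e)"
    and pos: "\<forall>e\<in>E. \<mu> e > 0"
    and tr: "(\<Sum>e\<in>E. \<mu> e) = 1"
    and pur: "(\<Sum>e\<in>E. (\<mu> e)\<^sup>2) = (\<Sum>i\<in>tuples I k. \<Sum>j\<in>tuples I k.
        (cmod (ell2_inner (branch k \<xi> i) (branch k \<xi> j)))\<^sup>2) / (real (card (tuples I k)))\<^sup>2"
    and eq: "dyads (tuples S k) (tuples I k) (\<lambda>_. 1 / real (card (tuples I k))) (branch k \<xi>)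
      = dyads (tuples S k) E \<mu> (\<lambda>e. e)"
    by (rule uniform_mixture_spectrum[where v = "branch k \<xi>",
        OF finite_tuples tuples_nonempty branch_ell2[OF _ assms] branch_norm[OF _ assms]]) blast+
  have "output_entropy k \<xi> = ereal (\<Sum>e\<in>E. - (\<mu> e * ln (\<mu> e)))"
    unfolding output_entropy_def output_dyads[OF assms] eq
    by (rule vN_entropy_dyads[OF E]) (use pos in blast)
  then show thesis
    using that[of E \<mu>] E pos tr pur eq by (simp add: card_tuples)
qed

lemma output_entropy_real:
  assumes "\<xi> \<in> pure k"
  shows "output_entropy k \<xi> = ereal (real_of_ereal (output_entropy k \<xi>))"
    and "real_of_ereal (output_entropy k \<xi>) \<ge> 0"
  by (rule output_spectrum[OF assms], simp,
      rule output_spectrum[OF assms], simp add: entropy_nonneg)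

lemma output_entropy_ge_neg_ln_purity:
  assumes \<xi>: "\<xi> \<in> pure k" and p: "p > 0"
    and le: "(\<Sum>i\<in>tuples I k. \<Sum>j\<in>tuples I k.
        (cmod (ell2_inner (branch k \<xi> i) (branch k \<xi> j)))\<^sup>2) / (real (card I ^ k))\<^sup>2 \<le> p"
  shows "output_entropy k \<xi> \<ge> ereal (- ln p)"
  by (rule output_spectrum[OF \<xi>]) (use le p in \<open>simp add: entropy_ge_neg_ln_purity\<close>)

text \<open>
  On a product input the channel power outputs a product state: its kernel factorizes, so its spectrum
  consists of the products of the eigenvalues of the factors.
\<close>

lemma output_entropy_product_input:
  assumes \<xi>: "\<xi> \<in> pure k" and \<eta>: "\<eta> \<in> pure m"
  obtains \<zeta> where "\<zeta> \<in> pure (k + m)"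
    "output_entropy (k + m) \<zeta> = output_entropy k \<xi> + output_entropy m \<eta>"
proof -
  interpret ps: product_split "tuples S (k + m)" "tuples S k" "tuples S m" "tuple_fst k" "tuple_snd k m"
    by (rule product_split_tuples)
  define \<zeta> where "\<zeta> = ps.tens \<xi> \<eta>"
  have \<zeta>: "\<zeta> \<in> pure (k + m)"
    using \<xi> \<eta> ps.tens_ell2 ps.tens_norm by (auto simp: pure_def \<zeta>_def)
  obtain E \<mu> where E: "finite E" "orthonormal (tuples S k) E (\<lambda>e. e)" "\<forall>e\<in>E. \<mu> e > 0"
      "(\<Sum>e\<in>E. \<mu> e) = 1"
    and eqE: "dyads (tuples S k) (tuples I k) (\<lambda>_. 1 / real (card (tuples I k))) (branch k \<xi>)
      = dyads (tuples S k) E \<mu> (\<lambda>e. e)"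
    and entE: "output_entropy k \<xi> = ereal (\<Sum>e\<in>E. - (\<mu> e * ln (\<mu> e)))"
    by (rule output_spectrum[OF \<xi>]) blast
  obtain F \<nu> where F: "finite F" "orthonormal (tuples S m) F (\<lambda>e. e)" "\<forall>e\<in>F. \<nu> e > 0"
      "(\<Sum>e\<in>F. \<nu> e) = 1"
    and eqF: "dyads (tuples S m) (tuples I m) (\<lambda>_. 1 / real (card (tuples I m))) (branch m \<eta>)
      = dyads (tuples S m) F \<nu> (\<lambda>e. e)"
    and entF: "output_entropy m \<eta> = ereal (\<Sum>e\<in>F. - (\<nu> e * ln (\<nu> e)))"
    by (rule output_spectrum[OF \<eta>]) blast
  let ?c = "1 / real (card (tuples I k)) * (1 / real (card (tuples I m)))"
  let ?ij = "\<lambda>i. (tuple_fst k i, tuple_snd k m i)"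
  have br: "branch (k + m) \<zeta> i = ps.tens (branch k \<xi> (tuple_fst k i)) (branch m \<eta> (tuple_snd k m i))"
    if i: "i \<in> tuples I (k + m)" for i
    unfolding branch_def \<zeta>_def
  proof (rule ps.tens_perm_vec)
    fix x assume "x \<in> tuples S (k + m)"
    then show "translate (k + m) i x \<in> tuples S (k + m)"
      using bij_betwE[OF translate_bij[OF i]] by blast
  qed (auto simp: translate_def tuple_map_def fun_eq_iff)
  have "dyads (tuples S (k + m)) (tuples I (k + m)) (\<lambda>_. 1 / real (card (tuples I (k + m)))) (branch (k + m) \<zeta>)
      = dyads (tuples S (k + m)) (tuples I k \<times> tuples I m) (\<lambda>(i, j). ?c)
          (\<lambda>(i, j). ps.tens (branch k \<xi> i) (branch m \<eta> j))"
  proof -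
    have c: "1 / real (card (tuples I (k + m))) = ?c" by (simp add: card_tuples power_add)
    have "(\<Sum>i\<in>tuples I (k + m). complex_of_real ?c * ell2_inner (branch (k + m) \<zeta> i) f * branch (k + m) \<zeta> i x)
        = (\<Sum>(i, j)\<in>tuples I k \<times> tuples I m. complex_of_real ?c
            * ell2_inner (ps.tens (branch k \<xi> i) (branch m \<eta> j)) f * ps.tens (branch k \<xi> i) (branch m \<eta> j) x)"
      for f x
      using sum.reindex_bij_betw[OF bij_betw_tuple_split[of k m I],
        of "\<lambda>(i, j). complex_of_real ?c * ell2_inner (ps.tens (branch k \<xi> i) (branch m \<eta> j)) f
            * ps.tens (branch k \<xi> i) (branch m \<eta> j) x"]
      by (simp add: br cong: sum.cong)
    then show ?thesis
      unfolding dyads_def c by (simp add: case_prod_unfold)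
  qed
  also have "\<dots> = dyads (tuples S (k + m)) (E \<times> F) (\<lambda>(a, b). \<mu> a * \<nu> b) (\<lambda>(a, b). ps.tens a b)"
    by (rule ps.tens_dyads_cong[OF branch_ell2[OF _ \<xi>] orthonormal_ell2[OF E(2)]
        branch_ell2[OF _ \<eta>] orthonormal_ell2[OF F(2)] eqE eqF])
  finally have "output_entropy (k + m) \<zeta>
      = vN_entropy (tuples S (k + m)) (dyads (tuples S (k + m)) (E \<times> F) (\<lambda>(a, b). \<mu> a * \<nu> b) (\<lambda>(a, b). ps.tens a b))"
    unfolding output_entropy_def output_dyads[OF \<zeta>] by simp
  also have "\<dots> = ereal (\<Sum>ab\<in>E \<times> F. - ((case ab of (a, b) \<Rightarrow> \<mu> a * \<nu> b) * ln (case ab of (a, b) \<Rightarrow> \<mu> a * \<nu> b)))"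
    by (rule vN_entropy_dyads) (use E F ps.tens_orthonormal[OF E(2) F(2)] in auto)
  also have "\<dots> = output_entropy k \<xi> + output_entropy m \<eta>"
    unfolding entE entF using entropy_product[of E \<mu> F \<nu>] E F by (simp add: case_prod_unfold)
  finally show thesis using that[OF \<zeta>] by blast
qed

text \<open>
  All output entropies are real, so the minimum output entropy is the infimum of a nonempty set of
  nonnegative reals.
\<close>

definition moe :: "nat \<Rightarrow> real" where
  "moe k = (INF \<xi>\<in>pure k. real_of_ereal (output_entropy k \<xi>))"

lemma pure_nonempty: "pure k \<noteq> {}"
proof -
  obtain s where "s \<in> S" using S by blast
  then have x: "(\<lambda>j\<in>{..<k}. s) \<in> tuples S k" by (auto simp: tuples_def)
  let ?b = "basis_vec (\<lambda>j\<in>{..<k}. s) :: (nat \<Rightarrow> 'a) \<Rightarrow> complex"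
  have b: "?b \<in> ell2 (tuples S k)" by (rule basis_vec_ell2[OF x])
  have "complex_of_real ((ell2_norm ?b)\<^sup>2) = 1"
    unfolding ell2_inner_self[OF b, symmetric] ell2_inner_basis_left by (simp add: basis_vec_def)
  then have "(ell2_norm ?b)\<^sup>2 = 1" by (simp only: of_real_eq_1_iff)
  then have "ell2_norm ?b = 1" using ell2_norm_nonneg[of ?b] by (simp add: power2_eq_1_iff)
  with b show ?thesis by (auto simp: pure_def)
qed

lemma entropies_bdd_below: "bdd_below ((\<lambda>\<xi>. real_of_ereal (output_entropy k \<xi>)) ` pure k)"
  by (rule bdd_belowI2[of _ 0]) (rule output_entropy_real)

lemma min_output_entropy_eq_moe:
  "min_output_entropy (tuples S k) (mixed_unitary_power S I V k) = ereal (moe k)"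
proof -
  have "min_output_entropy (tuples S k) (mixed_unitary_power S I V k) = (INF \<xi>\<in>pure k. output_entropy k \<xi>)"
    by (simp add: min_output_entropy_def pure_def output_entropy_def)
  also have "\<dots> = (INF \<xi>\<in>pure k. ereal (real_of_ereal (output_entropy k \<xi>)))"
    by (rule INF_cong[OF refl]) (rule output_entropy_real)
  also have "\<dots> = ereal (moe k)"
    unfolding moe_def using pure_nonempty
    by (subst ereal_Inf'[OF entropies_bdd_below]) (auto simp: image_image)
  finally show ?thesis .
qed

lemma moe_nonneg: "moe k \<ge> 0"
  unfolding moe_def by (rule cINF_greatest[OF pure_nonempty]) (rule output_entropy_real)

lemma moe_greatest:
  assumes "\<And>\<xi>. \<xi> \<in> pure k \<Longrightarrow> output_entropy k \<xi> \<ge> ereal c"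
  shows "moe k \<ge> c"
  unfolding moe_def
proof (rule cINF_greatest[OF pure_nonempty])
  fix \<xi> assume \<xi>: "\<xi> \<in> pure k"
  then show "c \<le> real_of_ereal (output_entropy k \<xi>)"
    using assms[OF \<xi>] output_entropy_real(1)[OF \<xi>] by (metis ereal_less_eq(3))
qed

text \<open>
  Product inputs are among the inputs of the larger power, and entropy is additive on them.
\<close>

lemma moe_subadditive: "moe (k + m) \<le> moe k + moe m"
proof -
  let ?r = "\<lambda>k \<xi>. real_of_ereal (output_entropy k \<xi>)"
  have prod: "moe (k + m) \<le> ?r k \<xi> + ?r m \<eta>" if \<xi>: "\<xi> \<in> pure k" and \<eta>: "\<eta> \<in> pure m" for \<xi> \<eta>
  proof -
    obtain \<zeta> where \<zeta>: "\<zeta> \<in> pure (k + m)"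
      and eq: "output_entropy (k + m) \<zeta> = output_entropy k \<xi> + output_entropy m \<eta>"
      by (rule output_entropy_product_input[OF \<xi> \<eta>])
    have "moe (k + m) \<le> ?r (k + m) \<zeta>"
      unfolding moe_def by (rule cINF_lower[OF entropies_bdd_below \<zeta>])
    also have "\<dots> = ?r k \<xi> + ?r m \<eta>"
      unfolding eq using output_entropy_real(1)[OF \<xi>] output_entropy_real(1)[OF \<eta>]
      by (metis plus_ereal.simps(1) real_of_ereal.simps(1))
    finally show ?thesis .
  qed
  have "moe (k + m) - ?r m \<eta> \<le> moe k" if "\<eta> \<in> pure m" for \<eta>
    unfolding moe_def[of k] by (rule cINF_greatest[OF pure_nonempty]) (use prod that in \<open>simp add: algebra_simps\<close>)
  then have "moe (k + m) - moe k \<le> moe m"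
    unfolding moe_def[of m] by (intro cINF_greatest[OF pure_nonempty]) (simp add: algebra_simps)
  then show ?thesis by simp
qed

end

text \<open>Fekete's lemma: the averages of a nonnegative subadditive sequence converge to their infimum.\<close>

lemma fekete_convergent:
  fixes h :: "nat \<Rightarrow> real"
  assumes sub: "\<And>m n. h (m + n) \<le> h m + h n" and nonneg: "\<And>n. h n \<ge> 0"
  shows "convergent (\<lambda>n. h n / real n)"
proof -
  define L where "L = (INF n\<in>{1..}. h n / real n)"
  have bdd: "bdd_below ((\<lambda>n. h n / real n) ` {1..})"
    by (rule bdd_belowI2[of _ 0]) (simp add: nonneg)
  have mult: "h (q * m + r) \<le> real q * h m + h r" for q m r
  proof (induction q)
    case (Suc q)
    have "h (Suc q * m + r) = h (m + (q * m + r))" by (simp add: add.assoc)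
    also have "\<dots> \<le> h m + h (q * m + r)" by (rule sub)
    finally show ?case using Suc by (simp add: algebra_simps)
  qed simp
  have "(\<lambda>n. h n / real n) \<longlonglongrightarrow> L"
  proof (rule LIMSEQ_I)
    fix e :: real assume e: "e > 0"
    have "\<exists>m\<in>{1..}. h m / real m < L + e / 2"
    proof (rule ccontr)
      assume "\<not> ?thesis"
      then have "L + e / 2 \<le> L"
        unfolding L_def[symmetric] by (subst (2) L_def) (intro cINF_greatest, auto simp: not_less)
      with e show False by simp
    qed
    then obtain m where m: "m \<ge> 1" "h m / real m < L + e / 2" by auto
    define B where "B = (\<Sum>r<m. h r)"
    have B: "h r \<le> B" if "r < m" for r
      unfolding B_def by (rule member_le_sum) (use that nonneg in auto)
    have "B \<ge> 0" unfolding B_def by (intro sum_nonneg nonneg)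
    obtain N :: nat where N: "real N > 2 * B / e" using reals_Archimedean2 by blast
    have "norm (h n / real n - L) < e" if n: "n \<ge> max 1 N" for n
    proof -
      have n0: "real n > 0" using n by simp
      have "h n \<le> real (n div m) * h m + h (n mod m)"
        using mult[of "n div m" m "n mod m"] by simp
      also have "\<dots> \<le> real (n div m) * h m + B" using B[of "n mod m"] m by simp
      also have "real (n div m) * h m \<le> real n / real m * h m"
        using nonneg[of m] by (intro mult_right_mono) (simp_all add: of_nat_div_le_of_nat)
      also have "\<dots> = real n * (h m / real m)" by simp
      also have "\<dots> \<le> real n * (L + e / 2)" using m n0 by (intro mult_left_mono) auto
      finally have "h n \<le> real n * (L + e / 2) + B" by simp
      moreover have "B < real n * (e / 2)"
      proof -
        have "2 * B / e < real n" using N n by linarith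
        then show ?thesis using e by (simp add: divide_less_eq)
      qed
      ultimately have "h n < (L + e) * real n" by (simp add: algebra_simps)
      then have "h n / real n < L + e" using n0 by (simp add: divide_less_eq)
      moreover have "L \<le> h n / real n"
        unfolding L_def by (rule cINF_lower[OF bdd]) (use n in auto)
      ultimately show ?thesis using e by (simp add: abs_less_iff)
    qed
    then show "\<exists>no. \<forall>n\<ge>no. norm (h n / real n - L) < e" by blast
  qed
  then show ?thesis by (rule convergentI)
qed

section \<open>Overlaps of translates under the free group\<close>

text \<open>
  For generators \<open>g\<^sub>i\<close>, \<open>g\<^sub>j\<close> and a reduced word \<open>x\<close>, the words \<open>g\<^sub>i\<^sup>-\<^sup>1x\<close> and \<open>g\<^sub>j\<^sup>-\<^sup>1x\<close> arise with or without
  cancellation. If \<open>i \<noteq> j\<close>, at most one of them involves a cancellation, which leaves three kinds.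
  For \<open>i = j\<close> the kind records the common index, because it could not be recovered from the two
  words.
\<close>

datatype cancellation = Same nat | Cancel_Left | Cancel_Right | Cancel_None

text \<open>Left multiplication by \<open>g\<^sub>i\<^sup>-\<^sup>1\<close>.\<close>

definition strip :: "nat \<Rightarrow> letter list \<Rightarrow> letter list" where
  "strip i = push_letter (i, False)"

definition cancellation_of :: "nat \<Rightarrow> nat \<Rightarrow> letter list \<Rightarrow> cancellation" where
  "cancellation_of i j x =
     (if i = j then Same i
      else if x \<noteq> [] \<and> hd x = (i, True) then Cancel_Left
      else if x \<noteq> [] \<and> hd x = (j, True) then Cancel_Right
      else Cancel_None)"

definition cancellations :: "nat \<Rightarrow> nat \<Rightarrow> cancellation set" where
  "cancellations i j = (if i = j then {Same i} else {Cancel_Left, Cancel_Right, Cancel_None})"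

text \<open>The number of kinds possible for a pair of indices, given one of them.\<close>

fun cancellation_weight :: "cancellation \<Rightarrow> real" where
  "cancellation_weight (Same i) = 1"
| "cancellation_weight c = 3"

lemma cancellation_of_mem: "cancellation_of i j x \<in> cancellations i j"
  by (auto simp: cancellation_of_def cancellations_def)

lemma card_cancellations:
  "c \<in> cancellations i j \<Longrightarrow> real (card (cancellations i j)) = cancellation_weight c"
  by (auto simp: cancellations_def split: if_splits)

lemma strip_Cons: "strip i (a # w) = (if a = (i, True) then w else (i, False) # a # w)"
  by (cases a) (auto simp: strip_def inv_letter_def)

lemma strip_Nil: "strip i [] = [(i, False)]"
  by (simp add: strip_def)

lemma strip_inj:
  assumes "strip i x = strip i y" "reduced x" "reduced y"
  shows "x = y"
  using assms push_push_inv[of _ "(i, True)"] unfolding strip_def inv_letter_def by (metis fst_conv snd_conv)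

text \<open>
  From the kind of cancellation and the two stripped words \<open>y = g\<^sub>i\<^sup>-\<^sup>1x\<close>, \<open>y' = g\<^sub>j\<^sup>-\<^sup>1x'\<close> one can read off
  everything. Without cancellation, \<open>i\<close> and \<open>j\<close> are the indices of the leading letters of \<open>y\<close> and \<open>y'\<close>.
  If \<open>x\<close> and \<open>x'\<close> begin with \<open>g\<^sub>i\<close>, then \<open>y'\<close> begins with \<open>g\<^sub>j\<^sup>-\<^sup>1g\<^sub>i\<close>, and \<open>x = g\<^sub>i y\<close>; likewise with the
  roles exchanged.
\<close>

lemma cancellation_recover:
  assumes red: "reduced x" "reduced x'" "reduced u" "reduced u'"
    and kinds: "cancellation_of i j x = c" "cancellation_of i j x' = c"
      "cancellation_of k l u = c" "cancellation_of k l u' = c"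
    and eqs: "strip i x = strip k u" "strip j x' = strip l u'"
  shows "i = k \<and> j = l \<and> x = u \<and> x' = u'"
proof (cases c)
  case (Same n)
  then have "i = n" "j = n" "k = n" "l = n"
    using kinds by (auto simp: cancellation_of_def split: if_splits)
  then show ?thesis using strip_inj[OF eqs(1)[unfolded \<open>i = n\<close> \<open>k = n\<close>]]
      strip_inj[OF eqs(2)[unfolded \<open>j = n\<close> \<open>l = n\<close>]] red by simp
next
  case Cancel_Left
  then obtain w w' v v' where "x = (i, True) # w" "x' = (i, True) # w'" "u = (k, True) # v" "u' = (k, True) # v'"
      "i \<noteq> j" "k \<noteq> l"
    using kinds by (cases x; cases x'; cases u; cases u') (auto simp: cancellation_of_def split: if_splits)
  then show ?thesis using eqs by (auto simp: strip_Cons split: if_splits)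
next
  case Cancel_Right
  then obtain w w' v v' where "x = (j, True) # w" "x' = (j, True) # w'" "u = (l, True) # v" "u' = (l, True) # v'"
      "i \<noteq> j" "k \<noteq> l"
    using kinds by (cases x; cases x'; cases u; cases u') (auto simp: cancellation_of_def split: if_splits)
  then show ?thesis using eqs by (auto simp: strip_Cons split: if_splits)
next
  case Cancel_None
  have ne: "strip a z = (a, False) # z" if "z = [] \<or> hd z \<noteq> (a, True)" for a z
    using that by (cases z) (auto simp: strip_Cons strip_Nil)
  have front: "strip i x = (i, False) # x" "strip j x' = (j, False) # x'"
    "strip k u = (k, False) # u" "strip l u' = (l, False) # u'"
    using kinds Cancel_None by (auto simp: cancellation_of_def split: if_splits intro!: ne)
  show ?thesis using eqs unfolding front by simp
qed

abbreviation words :: "letter list set" where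
  "words \<equiv> carrier free_group"

lemma words_eq: "words = {w. reduced w}"
  by (simp add: free_group_def)

lemma strip_bij: "bij_betw (strip i) words words"
  unfolding words_eq
  by (rule bij_betw_byWitness[where f' = "push_letter (i, True)"])
     (use push_push_inv[of _ "(i, True)"] push_inv_push[of _ "(i, True)"] in
       \<open>auto simp: strip_def inv_letter_def intro: reduced_push\<close>)

definition strip_tuple :: "nat \<Rightarrow> (nat \<Rightarrow> nat) \<Rightarrow> (nat \<Rightarrow> letter list) \<Rightarrow> nat \<Rightarrow> letter list" where
  "strip_tuple k i = tuple_map k (\<lambda>l. strip (i l))"

definition cancellation_tuple ::
  "nat \<Rightarrow> (nat \<Rightarrow> nat) \<Rightarrow> (nat \<Rightarrow> nat) \<Rightarrow> (nat \<Rightarrow> letter list) \<Rightarrow> nat \<Rightarrow> cancellation" where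
  "cancellation_tuple k i j x = (\<lambda>l\<in>{..<k}. cancellation_of (i l) (j l) (x l))"

definition tuple_weight :: "nat \<Rightarrow> (nat \<Rightarrow> cancellation) \<Rightarrow> real" where
  "tuple_weight k t = (\<Prod>l<k. cancellation_weight (t l))"

lemma tuple_weight_nonneg: "tuple_weight k t \<ge> 0"
proof -
  have "cancellation_weight c \<ge> 0" for c by (cases c) auto
  then show ?thesis unfolding tuple_weight_def by (intro prod_nonneg) auto
qed

lemma cancellation_tuple_recover:
  assumes i: "i \<in> tuples A k" "j \<in> tuples A k" "i' \<in> tuples A k" "j' \<in> tuples A k"
    and x: "x \<in> tuples words k" "y \<in> tuples words k" "x' \<in> tuples words k" "y' \<in> tuples words k"
    and kinds: "cancellation_tuple k i j x = t" "cancellation_tuple k i j y = t"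
      "cancellation_tuple k i' j' x' = t" "cancellation_tuple k i' j' y' = t"
    and eqs: "strip_tuple k i x = strip_tuple k i' x'" "strip_tuple k j y = strip_tuple k j' y'"
  shows "i = i' \<and> j = j' \<and> x = x' \<and> y = y'"
proof -
  have "i l = i' l \<and> j l = j' l \<and> x l = x' l \<and> y l = y' l" if l: "l < k" for l
  proof (rule cancellation_recover[where c = "t l"])
    show "reduced (x l)" "reduced (y l)" "reduced (x' l)" "reduced (y' l)"
      using x l by (auto simp: tuples_def words_eq)
    show "cancellation_of (i l) (j l) (x l) = t l" "cancellation_of (i l) (j l) (y l) = t l"
      "cancellation_of (i' l) (j' l) (x' l) = t l" "cancellation_of (i' l) (j' l) (y' l) = t l"
      using fun_cong[OF kinds(1), of l] fun_cong[OF kinds(2), of l]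
        fun_cong[OF kinds(3), of l] fun_cong[OF kinds(4), of l] l
      by (auto simp: cancellation_tuple_def)
    show "strip (i l) (x l) = strip (i' l) (x' l)" "strip (j l) (y l) = strip (j' l) (y' l)"
      using fun_cong[OF eqs(1), of l] fun_cong[OF eqs(2), of l] l
      by (auto simp: strip_tuple_def tuple_map_def)
  qed
  then show ?thesis
    using i x unfolding tuples_def by (auto intro: PiE_ext)
qed

text \<open>
  In each coordinate the admissible kinds are the \<open>N\<close> kinds \<open>Same i\<close> of weight 1 and three kinds of
  weight 3, and \<open>N + 3 \<sqdot> 3 = N + 9\<close>. This is the origin of the constant 9.
\<close>

lemma sum_tuple_weight:
  "(\<Sum>t\<in>PiE {..<k} (\<lambda>_. {Cancel_Left, Cancel_Right, Cancel_None} \<union> Same ` {..<N}). tuple_weight k t)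
    = (real N + 9) ^ k"
proof -
  let ?C = "{Cancel_Left, Cancel_Right, Cancel_None} \<union> Same ` {..<N}"
  have "(\<Sum>c\<in>?C. cancellation_weight c)
      = (\<Sum>c\<in>{Cancel_Left, Cancel_Right, Cancel_None}. cancellation_weight c)
        + (\<Sum>c\<in>Same ` {..<N}. cancellation_weight c)"
    by (rule sum.union_disjoint) auto
  also have "(\<Sum>c\<in>Same ` {..<N}. cancellation_weight c) = real N"
    by (subst sum.reindex) (auto simp: inj_on_def)
  finally have "(\<Sum>c\<in>?C. cancellation_weight c) = real N + 9" by simp
  then show ?thesis
    unfolding tuple_weight_def
    by (subst prod_sum_PiE[symmetric]) auto
qed

text \<open>
  Cauchy--Schwarz over the kinds of cancellation that are possible for a given pair of indices: their
  number is the weight of each of them.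
\<close>

lemma cancellation_split_bound:
  fixes a :: "(nat \<Rightarrow> letter list) \<Rightarrow> complex"
  assumes E: "finite E"
  shows "(cmod (\<Sum>x\<in>E. a x))\<^sup>2
    \<le> (\<Sum>t\<in>PiE {..<k} (\<lambda>l. cancellations (i l) (j l)).
        tuple_weight k t * (\<Sum>x\<in>{x \<in> E. cancellation_tuple k i j x = t}. cmod (a x))\<^sup>2)"
proof -
  let ?T = "PiE {..<k} (\<lambda>l. cancellations (i l) (j l))"
  let ?v = "\<lambda>t. \<Sum>x\<in>{x \<in> E. cancellation_tuple k i j x = t}. cmod (a x)"
  have fin: "finite ?T" by (intro finite_PiE) (auto simp: cancellations_def)
  have "cmod (\<Sum>x\<in>E. a x) \<le> (\<Sum>x\<in>E. cmod (a x))" by (rule norm_sum)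
  also have "\<dots> = (\<Sum>t\<in>?T. ?v t)"
    by (rule sum.group[OF E fin, symmetric])
       (simp add: cancellation_tuple_def image_subset_iff restrict_PiE_iff cancellation_of_mem)
  finally have "(cmod (\<Sum>x\<in>E. a x))\<^sup>2 \<le> (\<Sum>t\<in>?T. ?v t)\<^sup>2" by (intro power_mono) auto
  also have "\<dots> \<le> (\<Sum>t\<in>?T. (?v t)\<^sup>2) * real (card ?T)" by (rule sum_squared_le_sum_of_squares)
  also have "\<dots> = (\<Sum>t\<in>?T. tuple_weight k t * (?v t)\<^sup>2)"
    unfolding sum_distrib_right
  proof (rule sum.cong[OF refl])
    fix t assume t: "t \<in> ?T"
    have "real (card ?T) = (\<Prod>l<k. real (card (cancellations (i l) (j l))))"
      by (simp add: card_PiE)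
    also have "\<dots> = tuple_weight k t"
      unfolding tuple_weight_def by (intro prod.cong refl card_cancellations) (use t in auto)
    finally show "(?v t)\<^sup>2 * real (card ?T) = tuple_weight k t * (?v t)\<^sup>2" by simp
  qed
  finally show ?thesis .
qed

text \<open>
  After a second application of Cauchy--Schwarz, now in \<open>x\<close>, the injectivity of
  \<open>(i, j, x, y) \<mapsto> (t, g\<^sub>i\<^sup>-\<^sup>1x, g\<^sub>j\<^sup>-\<^sup>1y)\<close> turns the sum over all pairs of indices into at most one copy of
  \<open>\<parallel>\<xi>\<parallel>\<^sup>4\<close> for each kind \<open>t\<close>.
\<close>

lemma finite_overlap_bound:
  fixes \<xi> :: "(nat \<Rightarrow> letter list) \<Rightarrow> complex"
  assumes \<xi>: "\<xi> \<in> ell2 (tuples words k)" and E: "finite E" "E \<subseteq> tuples words k"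
  shows "(\<Sum>i\<in>tuples {..<N} k. \<Sum>j\<in>tuples {..<N} k.
      (cmod (\<Sum>x\<in>E. cnj (\<xi> (strip_tuple k i x)) * \<xi> (strip_tuple k j x)))\<^sup>2)
    \<le> (real N + 9) ^ k * (ell2_norm \<xi>) ^ 4"
proof -
  let ?I = "tuples {..<N} k"
  let ?C = "PiE {..<k} (\<lambda>_. {Cancel_Left, Cancel_Right, Cancel_None} \<union> Same ` {..<N})"
  let ?kind = "cancellation_tuple k" and ?s = "strip_tuple k"
  define p where "p = (\<lambda>x. (cmod (\<xi> x))\<^sup>2)"
  have p: "p x \<ge> 0" for x by (simp add: p_def)
  have finI: "finite ?I" unfolding tuples_def by (intro finite_PiE) auto
  have finC: "finite ?C" by (intro finite_PiE) auto
  let ?D = "\<lambda>i j t. {x \<in> E. ?kind i j x = t}"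
  \<comment> \<open>\<open>?\<Omega>\<close> collects the terms \<open>((i, j), t, x, y)\<close> that arise from expanding all squares; \<open>?\<Psi>\<close> is the
    injective map described above.\<close>
  let ?\<Omega> = "SIGMA ij:?I \<times> ?I. SIGMA t:?C. ?D (fst ij) (snd ij) t \<times> ?D (fst ij) (snd ij) t"
  let ?\<Psi> = "\<lambda>(ij, t, x, y). (t, ?s (fst ij) x, ?s (snd ij) y)"
  let ?Y = "\<Union>i\<in>?I. ?s i ` E"
  have finY: "finite ?Y" using finI E by auto
  have pair: "(cmod (\<Sum>x\<in>E. cnj (\<xi> (?s i x)) * \<xi> (?s j x)))\<^sup>2
      \<le> (\<Sum>t\<in>?C. \<Sum>(x, y)\<in>?D i j t \<times> ?D i j t. tuple_weight k t * (p (?s i x) * p (?s j y)))"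
    if i: "i \<in> ?I" and j: "j \<in> ?I" for i j
  proof -
    let ?T = "PiE {..<k} (\<lambda>l. cancellations (i l) (j l))"
    have "(cmod (\<Sum>x\<in>E. cnj (\<xi> (?s i x)) * \<xi> (?s j x)))\<^sup>2
        \<le> (\<Sum>t\<in>?T. tuple_weight k t * (\<Sum>x\<in>?D i j t. cmod (cnj (\<xi> (?s i x)) * \<xi> (?s j x)))\<^sup>2)"
      by (rule cancellation_split_bound[OF E(1)])
    also have "\<dots> \<le> (\<Sum>t\<in>?C. tuple_weight k t * (\<Sum>x\<in>?D i j t. cmod (cnj (\<xi> (?s i x)) * \<xi> (?s j x)))\<^sup>2)"
    proof (rule sum_mono2[OF finC])
      have "cancellations (i l) (j l) \<subseteq> {Cancel_Left, Cancel_Right, Cancel_None} \<union> Same ` {..<N}"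
        if "l < k" for l
        using that i j by (auto simp: cancellations_def tuples_def)
      then show "?T \<subseteq> ?C" by (intro PiE_mono) auto
    qed (intro mult_nonneg_nonneg tuple_weight_nonneg zero_le_power2)
    also have "\<dots> \<le> (\<Sum>t\<in>?C. tuple_weight k t * ((\<Sum>x\<in>?D i j t. p (?s i x)) * (\<Sum>y\<in>?D i j t. p (?s j y))))"
      by (intro sum_mono mult_left_mono tuple_weight_nonneg)
         (simp add: p_def norm_mult Cauchy_Schwarz_ineq_sum)
    also have "\<dots> = (\<Sum>t\<in>?C. \<Sum>(x, y)\<in>?D i j t \<times> ?D i j t. tuple_weight k t * (p (?s i x) * p (?s j y)))"
      unfolding sum_product unfolding sum.cartesian_product unfolding sum_distrib_left
      by (simp add: case_prod_unfold)
    finally show ?thesis .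
  qed
  have "(\<Sum>i\<in>?I. \<Sum>j\<in>?I. (cmod (\<Sum>x\<in>E. cnj (\<xi> (?s i x)) * \<xi> (?s j x)))\<^sup>2)
      \<le> (\<Sum>i\<in>?I. \<Sum>j\<in>?I. \<Sum>t\<in>?C. \<Sum>(x, y)\<in>?D i j t \<times> ?D i j t. tuple_weight k t * (p (?s i x) * p (?s j y)))"
    by (intro sum_mono pair)
  also have "\<dots> = (\<Sum>ij\<in>?I \<times> ?I. \<Sum>t\<in>?C. \<Sum>xy\<in>?D (fst ij) (snd ij) t \<times> ?D (fst ij) (snd ij) t.
      tuple_weight k t * (p (?s (fst ij) (fst xy)) * p (?s (snd ij) (snd xy))))"
    by (subst sum.cartesian_product) (simp only: case_prod_unfold)
  also have "\<dots> = (\<Sum>ij\<in>?I \<times> ?I. \<Sum>txy\<in>(SIGMA t:?C. ?D (fst ij) (snd ij) t \<times> ?D (fst ij) (snd ij) t).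
      tuple_weight k (fst txy) * (p (?s (fst ij) (fst (snd txy))) * p (?s (snd ij) (snd (snd txy)))))"
    using finC E(1) by (intro sum.cong refl, subst sum.Sigma) (auto simp: case_prod_unfold)
  also have "\<dots> = (\<Sum>\<omega>\<in>?\<Omega>. tuple_weight k (fst (snd \<omega>)) *
      (p (?s (fst (fst \<omega>)) (fst (snd (snd \<omega>)))) * p (?s (snd (fst \<omega>)) (snd (snd (snd \<omega>))))))"
    using finI finC E(1) by (subst sum.Sigma) (auto simp: case_prod_unfold)
  also have "\<dots> = (\<Sum>\<omega>\<in>?\<Omega>. (\<lambda>(t, y, y'). tuple_weight k t * (p y * p y')) (?\<Psi> \<omega>))"
    by (simp add: case_prod_unfold)
  also have "\<dots> = (\<Sum>(t, y, y')\<in>?\<Psi> ` ?\<Omega>. tuple_weight k t * (p y * p y'))"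
  proof (rule sum.reindex[unfolded o_def, symmetric])
    show "inj_on ?\<Psi> ?\<Omega>"
    proof (rule inj_onI)
      fix \<omega> \<omega>' assume mem: "\<omega> \<in> ?\<Omega>" "\<omega>' \<in> ?\<Omega>" and eq: "?\<Psi> \<omega> = ?\<Psi> \<omega>'"
      obtain i j t x y where \<omega>: "\<omega> = ((i, j), t, x, y)" by (metis surj_pair)
      obtain i' j' t' x' y' where \<omega>': "\<omega>' = ((i', j'), t', x', y')" by (metis surj_pair)
      have "i = i' \<and> j = j' \<and> x = x' \<and> y = y'"
        by (rule cancellation_tuple_recover[where A = "{..<N}" and k = k and t = t])
           (use mem eq E(2) in \<open>auto simp: \<omega> \<omega>'\<close>)
      then show "\<omega> = \<omega>'" using eq by (simp add: \<omega> \<omega>')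
    qed
  qed
  also have "\<dots> \<le> (\<Sum>(t, y, y')\<in>?C \<times> ?Y \<times> ?Y. tuple_weight k t * (p y * p y'))"
  proof (rule sum_mono2)
    show "finite (?C \<times> ?Y \<times> ?Y)" using finC finY by auto
    show "?\<Psi> ` ?\<Omega> \<subseteq> ?C \<times> ?Y \<times> ?Y"
    proof (rule image_subsetI)
      fix \<omega> assume mem: "\<omega> \<in> ?\<Omega>"
      obtain i j t x y where \<omega>: "\<omega> = ((i, j), t, x, y)" by (metis surj_pair)
      have t: "t \<in> ?C" and ij: "i \<in> ?I" "j \<in> ?I" and xy: "x \<in> E" "y \<in> E"
        using mem unfolding \<omega> mem_Sigma_iff by simp_all
      have "?s i x \<in> ?Y" "?s j y \<in> ?Y"
        using ij xy by blast+
      then show "?\<Psi> \<omega> \<in> ?C \<times> ?Y \<times> ?Y"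
        unfolding \<omega> case_prod_conv fst_conv snd_conv mem_Sigma_iff using t by (intro conjI)
    qed
  next
    fix tyy
    show "0 \<le> (case tyy of (t, y, y') \<Rightarrow> tuple_weight k t * (p y * p y'))"
      unfolding case_prod_unfold by (intro mult_nonneg_nonneg tuple_weight_nonneg p)
  qed
  also have "\<dots> = (\<Sum>t\<in>?C. \<Sum>yy\<in>?Y \<times> ?Y. tuple_weight k t * (p (fst yy) * p (snd yy)))"
    by (simp only: sum.cartesian_product case_prod_unfold)
  also have "\<dots> = (\<Sum>t\<in>?C. tuple_weight k t) * (\<Sum>yy\<in>?Y \<times> ?Y. p (fst yy) * p (snd yy))"
    by (simp only: sum_product)
  also have "(\<Sum>yy\<in>?Y \<times> ?Y. p (fst yy) * p (snd yy)) = (\<Sum>y\<in>?Y. p y) * (\<Sum>y\<in>?Y. p y)"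
    by (simp only: sum_product sum.cartesian_product case_prod_unfold)
  also have "(\<Sum>t\<in>?C. tuple_weight k t) * ((\<Sum>y\<in>?Y. p y) * (\<Sum>y\<in>?Y. p y))
      \<le> (real N + 9) ^ k * ((ell2_norm \<xi>)\<^sup>2 * (ell2_norm \<xi>)\<^sup>2)"
  proof -
    have "(\<Sum>y\<in>?Y. p y) \<le> (ell2_norm \<xi>)\<^sup>2"
      unfolding ell2_norm_sq p_def
      by (rule finite_sum_le_infsum[OF ell2_summable[OF \<xi>] finY]) auto
    moreover have "(\<Sum>y\<in>?Y. p y) \<ge> 0" by (intro sum_nonneg p)
    ultimately show ?thesis
      unfolding sum_tuple_weight by (intro mult_left_mono mult_mono) auto
  qed
  finally show ?thesis by (simp add: power_add[symmetric])
qed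

text \<open>
  The bound for finite sets of words passes to the limit, because each inner product is the limit of
  its partial sums.
\<close>

lemma overlap_bound:
  fixes \<xi> :: "(nat \<Rightarrow> letter list) \<Rightarrow> complex"
  assumes \<xi>: "\<xi> \<in> ell2 (tuples words k)"
  shows "(\<Sum>i\<in>tuples {..<N} k. \<Sum>j\<in>tuples {..<N} k.
      (cmod (ell2_inner (perm_vec (tuples words k) (strip_tuple k i) \<xi>)
        (perm_vec (tuples words k) (strip_tuple k j) \<xi>)))\<^sup>2)
    \<le> (real N + 9) ^ k * (ell2_norm \<xi>) ^ 4"
proof -
  let ?X = "tuples words k" and ?I = "tuples {..<N} k"
  let ?v = "\<lambda>i. perm_vec ?X (strip_tuple k i) \<xi>"
  have v: "?v i \<in> ell2 ?X" for i
    unfolding strip_tuple_def by (intro perm_vec_ell2 bij_betw_tuple_map strip_bij \<xi>)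
  have lim: "((\<lambda>E. \<Sum>x\<in>E. cnj (\<xi> (strip_tuple k i x)) * \<xi> (strip_tuple k j x))
      \<longlongrightarrow> ell2_inner (?v i) (?v j)) (finite_subsets_at_top ?X)" for i j
  proof -
    have "((\<lambda>x. cnj (?v i x) * ?v j x) has_sum ell2_inner (?v i) (?v j)) UNIV"
      unfolding ell2_inner_def by (rule has_sum_infsum[OF ell2_inner_summable[OF v v]])
    also have "?this \<longleftrightarrow> ((\<lambda>x. cnj (\<xi> (strip_tuple k i x)) * \<xi> (strip_tuple k j x))
        has_sum ell2_inner (?v i) (?v j)) ?X"
      by (rule has_sum_cong_neutral) (auto simp: perm_vec_def)
    finally show ?thesis by (simp add: has_sum_def)
  qed
  have "((\<lambda>E. \<Sum>i\<in>?I. \<Sum>j\<in>?I. (cmod (\<Sum>x\<in>E. cnj (\<xi> (strip_tuple k i x)) * \<xi> (strip_tuple k j x)))\<^sup>2)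
      \<longlongrightarrow> (\<Sum>i\<in>?I. \<Sum>j\<in>?I. (cmod (ell2_inner (?v i) (?v j)))\<^sup>2)) (finite_subsets_at_top ?X)"
    by (intro tendsto_sum tendsto_power tendsto_norm lim)
  then show ?thesis
    by (rule tendsto_upperbound)
       (auto simp: \<xi> intro!: eventually_finite_subsets_at_top_weakI finite_overlap_bound)
qed

section \<open>The minimum output entropy of the free channel\<close>

lemma inv_free_gen: "inv\<^bsub>free_group\<^esub> (free_gen i) = [(i, False)]"
proof -
  interpret group free_group by (rule group_free_group)
  show ?thesis
    by (rule inv_equality) (simp_all add: free_group_def free_gen_def inv_letter_def)
qed

lemma free_unitary_eq: "free_unitary i = perm_op words (strip i)"
proof -
  have "inv\<^bsub>free_group\<^esub> (free_gen i) \<otimes>\<^bsub>free_group\<^esub> x = strip i x" for x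
    unfolding inv_free_gen by (simp add: free_group_def strip_def)
  then show ?thesis
    unfolding free_unitary_def left_translation_def perm_op_def perm_vec_def by (simp only:)
qed

lemma permutation_channel_free:
  assumes "N \<ge> 1"
  shows "permutation_channel words {..<N} free_unitary strip"
proof
  show "words \<noteq> {}" by (auto simp: words_eq intro: exI[of _ "[]"])
qed (use assms in \<open>auto simp: strip_bij free_unitary_eq lessThan_empty_iff\<close>)

context
  fixes N :: nat
  assumes N: "N \<ge> 1"
begin

interpretation free: permutation_channel words "{..<N}" free_unitary strip
  by (rule permutation_channel_free[OF N])

text \<open>
  The purity of an output is \<open>N\<^sup>-\<^sup>2\<^sup>k\<close> times the sum of the squared overlaps, hence at most
  \<open>((N + 9) / N\<^sup>2)\<^sup>k\<close>.
\<close>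

lemma free_moe_lower_bound: "free.moe k \<ge> real k * ln (real N) - real k * ln (1 + 9 / real N)"
proof (rule free.moe_greatest)
  fix \<xi> assume \<xi>: "\<xi> \<in> free.pure k"
  have N0: "real N > 0" using N by simp
  let ?p = "((1 + 9 / real N) / real N) ^ k"
  have p: "?p > 0" using N0 by (intro zero_less_power divide_pos_pos add_pos_pos) auto
  have "(\<Sum>i\<in>tuples {..<N} k. \<Sum>j\<in>tuples {..<N} k.
        (cmod (ell2_inner (free.branch k \<xi> i) (free.branch k \<xi> j)))\<^sup>2) \<le> (real N + 9) ^ k"
    using overlap_bound[of \<xi> k N] \<xi>
    by (simp add: free.pure_def free.branch_def free.translate_def strip_tuple_def)
  then have "(\<Sum>i\<in>tuples {..<N} k. \<Sum>j\<in>tuples {..<N} k.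
        (cmod (ell2_inner (free.branch k \<xi> i) (free.branch k \<xi> j)))\<^sup>2) / (real (card {..<N} ^ k))\<^sup>2
      \<le> (real N + 9) ^ k / (real (N ^ k))\<^sup>2"
    by (simp add: divide_right_mono)
  also have "\<dots> = ((real N + 9) / (real N)\<^sup>2) ^ k"
    by (simp add: power_divide power_mult[symmetric] mult.commute)
  also have "(real N + 9) / (real N)\<^sup>2 = (1 + 9 / real N) / real N"
    using N0 by (simp add: field_simps power2_eq_square)
  finally have "free.output_entropy k \<xi> \<ge> ereal (- ln ?p)"
    by (rule free.output_entropy_ge_neg_ln_purity[OF \<xi> p])
  moreover have "1 + 9 / real N > 0" using N0 by (simp add: add_pos_pos)
  then have "- ln ?p = real k * ln (real N) - real k * ln (1 + 9 / real N)"
    using N0 by (simp add: ln_realpow ln_div right_diff_distrib)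
  ultimately show "free.output_entropy k \<xi> \<ge> ereal (real k * ln (real N) - real k * ln (1 + 9 / real N))"
    by simp
qed

lemma free_min_output_entropy: "min_output_entropy (tuples words k) (free_channel_power N k) = ereal (free.moe k)"
  unfolding free_channel_power_def by (rule free.min_output_entropy_eq_moe)

lemma free_moe_average_convergent: "convergent (\<lambda>k. free.moe k / real k)"
  by (rule fekete_convergent) (rule free.moe_subadditive, rule free.moe_nonneg)

end

lemma free_moe_facts:
  assumes "N \<ge> 1"
  obtains h where
    "\<And>k. min_output_entropy (tuples words k) (free_channel_power N k) = ereal (h k)"
    "\<And>k. h k \<ge> real k * ln (real N) - real k * ln (1 + 9 / real N)"
    "convergent (\<lambda>k. h k / real k)"
  by (rule that[OF free_min_output_entropy[OF assms] free_moe_lower_bound[OF assms]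
      free_moe_average_convergent[OF assms]])

text \<open>\<open>1 + x \<le> (1 + \<surd>x)\<^sup>2\<close>, applied to \<open>x = a\<^sup>k - 1\<close>.\<close>

lemma ln_power_le_two_ln_sqrt:
  assumes "a \<ge> (1 :: real)"
  shows "real k * ln a \<le> 2 * ln (1 + sqrt (a ^ k - 1))"
proof -
  have x: "a ^ k - 1 \<ge> 0" using assms one_le_power[of a k] by simp
  have "a ^ k \<le> (1 + sqrt (a ^ k - 1))\<^sup>2"
    using x by (simp add: power2_sum)
  then have "ln (a ^ k) \<le> ln ((1 + sqrt (a ^ k - 1))\<^sup>2)"
    using assms by (intro ln_mono) (auto intro: zero_less_power)
  moreover have "1 + sqrt (a ^ k - 1) > 0"
    using x by (simp add: add_pos_nonneg)
  ultimately show ?thesis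
    using assms by (simp add: ln_realpow)
qed

theorem theorem3p5:
  fixes N :: nat
  assumes "N \<ge> 1"
  shows "(\<forall>k::nat. min_output_entropy (tuples (carrier free_group) k) (free_channel_power N k)
            \<ge> ereal (real k * ln (real N) - 2 * ln (1 + sqrt ((1 + 9 / real N) ^ k - 1)))) \<and>
         convergent (\<lambda>k. ereal (1 / real k) *
            min_output_entropy (tuples (carrier free_group) k) (free_channel_power N k)) \<and>
         regularized_MOE (carrier free_group) (free_channel_power N)
            \<ge> ereal (ln (real N) - ln (1 + 9 / real N)) \<and>
         ln (real N) - ln (1 + 9 / real N) \<ge> ln (real N) - 9 / real N"
proof -
  obtain h where moe: "\<And>k. min_output_entropy (tuples (carrier free_group) k) (free_channel_power N k) = ereal (h k)"
    and bound: "\<And>k. h k \<ge> real k * ln (real N) - real k * ln (1 + 9 / real N)"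
    and conv: "convergent (\<lambda>k. h k / real k)"
    by (rule free_moe_facts[OF assms]) blast
  have a: "1 + 9 / real N \<ge> 1" by simp
  have "real k * ln (real N) - 2 * ln (1 + sqrt ((1 + 9 / real N) ^ k - 1)) \<le> h k" for k
    using bound[of k] ln_power_le_two_ln_sqrt[OF a, of k] by linarith
  moreover
  have avg: "ereal (1 / real k) * min_output_entropy (tuples (carrier free_group) k) (free_channel_power N k)
      = ereal (h k / real k)" for k
    by (simp add: moe)
  obtain l where l: "(\<lambda>k. h k / real k) \<longlonglongrightarrow> l" using conv by (auto simp: convergent_def)
  then have lim: "(\<lambda>k. ereal (1 / real k) *
      min_output_entropy (tuples (carrier free_group) k) (free_channel_power N k)) \<longlonglongrightarrow> ereal l"
    unfolding avg by (rule tendsto_ereal)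
  have "ln (real N) - ln (1 + 9 / real N) \<le> l"
  proof (rule LIMSEQ_le_const[OF l], intro exI allI impI)
    fix k :: nat assume "1 \<le> k"
    then have k: "real k > 0" by simp
    have "(ln (real N) - ln (1 + 9 / real N)) * real k \<le> h k"
      using bound[of k] by (simp add: algebra_simps)
    then show "ln (real N) - ln (1 + 9 / real N) \<le> h k / real k"
      using k by (simp add: pos_le_divide_eq)
  qed
  moreover have "regularized_MOE (carrier free_group) (free_channel_power N) = ereal l"
    unfolding regularized_MOE_def by (rule limI[OF lim])
  moreover have "ln (1 + 9 / real N) \<le> 9 / real N"
    by (rule ln_add_one_self_le_self) simp
  ultimately show ?thesis
    using lim by (auto simp: moe convergent_def)
qed

end
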